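(* Suppose an $s$-stage TVD Runge–Kutta method of order greater than or equal to $d$ is used both for the stage metric terms $\{J_{K^{n,i}}\}_{i=0}^s$ and for the fully-discrete ALE-DG method described in the context, and that the values $\{J_{K^{n,i}}\}_{i=0}^s$ are used to compute the metric terms in the fully-discrete method. Then the fully-discrete ALE-DG method satisfies the discrete geometric conservation law: for all $c\in\mathbb R$ and $n=0,\dots,\mathcal N-1$, $$u_h(\mathbf x,t_n)=c\ \text{ for all }\mathbf x\in\Omega\quad\Longrightarrow\quad u_h(\mathbf x,t_{n+1})=c\ \text{ for all }\mathbf x\in\Omega .$$
   Context: **Moving mesh.** $\Omega\subseteq\mathbb R^d$ is an open convex polyhedron, $t_n$, $n=0,\dots,\mathcal N$, are the time levels in $[0,T]$, $\Delta t=t_{n+1}-t_n$. $\mathcal T_{(t_n)}$ and $\mathcal T_{(t_{n+1})}$ are regular simplicial meshes of $\Omega$ with the same topology (same number of cells, with corresponding cells and vertices, all cells positively oriented with respect to $K_{\rm ref}=\{\boldsymbol\xi\in\mathbb R^d:\xi_\nu\ge0,\ \sum_\nu\xi_\nu\le1\}$). For corresponding vertices $\mathbf v_\ell^n,\mathbf v_\ell^{n+1}$ ($\ell=1,\dots,d+1$) of a cell and $t\in[t_n,t_{n+1}]$ set $\mathbf v_\ell(t)=\mathbf v_\ell^n+\frac{t-t_n}{\Delta t}(\mathbf v_\ell^{n+1}-\mathbf v_\ell^n)$, $K(t)=\operatorname{int}\operatorname{conv}\{\mathbf v_1(t),\dots,\mathbf v_{d+1}(t)\}$, $\mathbf A_{K(t)}=(\mathbf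 v_2(t)-\mathbf v_1(t),\dots,\mathbf v_{d+1}(t)-\mathbf v_1(t))$, $J_{K(t)}=\det\mathbf A_{K(t)}=d!\,|K(t)|$, $\boldsymbol\chi_{K(t)}(\boldsymbol\xi,t)=\mathbf A_{K(t)}\boldsymbol\xi+\mathbf v_1(t)$; $\mathcal T_{(t)}$ is the set of all cells $K(t)$. With $h_{K(t)}$ the diameter of $K(t)$, $\rho_{K(t)}$ the radius of the largest ball contained in $K(t)$, and $h=\max_{t\in[0,T]}\max_{K(t)\in\mathcal T_{(t)}}h_{K(t)}$, it is assumed for all $t\in[0,T]$ that: (A1) $\overline\Omega=\bigcup_{K(t)\in\mathcal T_{(t)}}\overline{K(t)}$; (A2) $J_{K(t)}>0$ for all cells; (A3) there are constants $\kappa,\tau>0$ independent of $h$ with $h_{K(t)}\le\kappa\rho_{K(t)}$ and $h\le\tau h_{K(t)}$ for all cells. The grid velocity, as a function on $K_{\rm ref}$, is $\boldsymbol\omega(t)=\boldsymbol\omega(\boldsymbol\xi,t)=\frac{d}{dt}\boldsymbol\chi_{K(t)}(\boldsymbol\xi,t)$. A star denotes pull-back: $v^*=v\circ\boldsymbol\chi_{K(t)}$. $\mathcal V_h(t)=\{v\in L^2(\Omega):v^*\in P^k(K_{\rm ref})\text{ for all cells}\}$, where $P^k(K_{\rm ref})$ is the space of polynomials of degree at most $k$. $(\cdot,\cdot)_{K_{\rm ref}}$ is the $L^2$ inner product on $K_{\rm ref}$, $\langle\cdot,\cdot\rangle_{\partial K_{\rm ref}}$ that on $\partial K_{\rm ref}$,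 and $\mathbf n_{K_{\rm ref}}$ is the outward normal of $K_{\rm ref}$. **Flux.** The problem is the scalar conservation law $\partial_tu+\nabla\cdot\boldsymbol f(u)=0$ in $\Omega\times(0,T)$ with an initial condition and suitable boundary conditions, where $\boldsymbol f:\mathbb R\to\mathbb R^d$ is a suitable vector field; $\boldsymbol g(\boldsymbol\omega,u)=\boldsymbol f(u)-\boldsymbol\omega u$. The numerical flux $\widehat g(\boldsymbol\omega,u_1,u_2,\mathbf n)$, where $\mathbf n$ is a (not necessarily normalized) normal vector, satisfies: consistency $\widehat g(\boldsymbol\omega,u,u,\mathbf n)=\boldsymbol g(\boldsymbol\omega,u)\cdot\mathbf n$; it is increasing and Lipschitz continuous in $u_1$; it is decreasing and Lipschitz continuous in $u_2$; and $\widehat g(\boldsymbol\omega,u_1,u_2,\mathbf n)=-\widehat g(\boldsymbol\omega,u_2,u_1,-\mathbf n)$. For a number $J$ and a time $t$ put $$\mathcal G(u_h^*,v^*,J,t)=\big(J\mathbf A_{K(t)}^{-1}\boldsymbol g(\boldsymbol\omega(t),u_h^* ),\nabla_{\boldsymbol\xi}v^*\big)_{K_{\rm ref}}-\big\langle\widehat g(\boldsymbol\omega,u_h^{*,\mathrm{int}},u_h^{*,\mathrm{ext}},J\mathbf A_{K(t)}^{-T}\mathbf n_{K_{\rm ref}}),v^{*,\mathrm{int}}\big\rangle_{\partial K_{\rm ref}},$$ where int and ext denote the pulled-back traces from inside and outside the cell. **TVD Runge–Kutta method.** For $u_t=q(u,t)$: $u^{n,0}=u^n$, $u^{n,i}=\sum_{j=0}^{i-1}(\alpha_{ij}u^{n,j}+\Delta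 t\,\beta_{ij}q(u^{n,j},t_{n+\gamma_j}))$ for $i=1,\dots,s$, $u^{n+1}=u^{n,s}$, with $t_{n+\gamma_j}=t_n+\gamma_j\Delta t$, $0\le\gamma_j\le1$, $\alpha_{ij},\beta_{ij}\ge0$, $\alpha_{ij}=0\Rightarrow\beta_{ij}=0$, $\sum_{j=0}^{i-1}\alpha_{ij}=1$. **Stage metric terms.** With $K^{n+\gamma_j}=K(t_{n+\gamma_j})$, $\boldsymbol\omega^{n+\gamma_j}=\boldsymbol\omega(t_{n+\gamma_j})$: $J_{K^{n,0}}=J_{K^n}=J_{K(t_n)}$, $$J_{K^{n,i}}=\sum_{j=0}^{i-1}\Big(\alpha_{ij}J_{K^{n,j}}+\beta_{ij}\Delta t\big(\nabla_{\boldsymbol\xi}\cdot[\mathbf A_{K^{n+\gamma_j}}^{-1}\boldsymbol\omega^{n+\gamma_j}]\big)J_{K^{n,j}}\Big),\quad i=1,\dots,s,$$ and $J_{K^{n+1}}=J_{K^{n,s}}$. This is the Runge–Kutta method applied to the ODE $\frac{d}{dt}J_{K(t)}=(\nabla_{\boldsymbol\xi}\cdot[\mathbf A_{K(t)}^{-1}\boldsymbol\omega])J_{K(t)}$. **Fully-discrete ALE-DG method.** The stage functions $u_h^{n,i,*}$ (on $K_{\rm ref}$, for each cell, polynomials of degree at most $k$) satisfy, for every cell and every $v\in\mathcal V_h(t)$, $(J_{K^{n,0}}u_h^{n,0,*},v^* )_{K_{\rm ref}}=(J_{K^n}u_h^{n,*},v^* )_{K_{\rm ref}}$, for $i=1,\dots,s$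 $$(J_{K^{n,i}}u_h^{n,i,*},v^* )_{K_{\rm ref}}=\sum_{j=0}^{i-1}\alpha_{ij}(J_{K^{n,j}}u_h^{n,j,*},v^* )_{K_{\rm ref}}+\sum_{j=0}^{i-1}\beta_{ij}\Delta t\,\mathcal G(u_h^{n,j,*},v^*,J_{K^{n,j}},t_{n+\gamma_j}),$$ and $(J_{K^{n+1}}u_h^{n+1,*},v^* )_{K_{\rm ref}}=(J_{K^{n,s}}u_h^{n,s,*},v^* )_{K_{\rm ref}}$. The function $u_h(\cdot,t_n)\in\mathcal V_h(t_n)$ is the one with pull-backs $u_h^{n,*}$.
   Formalization: It is additionally assumed that all stage metric terms J_{K^{n,i}} are nonzero, since otherwise the stage equations do not determine the solution and the claim can fail; "suitable" boundary conditions are read as those that give exterior state c for a constant state c. *)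

theory Defs
  imports "HOL-Analysis.Analysis"
begin

section \<open>Reference simplex\<close>

definition ref_simplex :: "(real ^ 'd) set" where
  "ref_simplex = {\<xi>. (\<forall>\<nu>. 0 \<le> \<xi> $ \<nu>) \<and> (\<Sum>\<nu>\<in>UNIV. \<xi> $ \<nu>) \<le> 1}"

text \<open>Polynomials of total degree at most \<open>k\<close>; \<open>m\<close> ranges over the multi-indices.\<close>

definition poly_space :: "nat \<Rightarrow> (real ^ 'd \<Rightarrow> real) set" where
  "poly_space k = {p. \<exists>c :: ('d \<Rightarrow> nat) \<Rightarrow> real.
     p = (\<lambda>\<xi>. \<Sum>m | (\<Sum>\<nu>\<in>UNIV. m \<nu>) \<le> k. c m * (\<Prod>\<nu>\<in>UNIV. (\<xi> $ \<nu>) ^ m \<nu>))}"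

definition grad :: "(real ^ 'd \<Rightarrow> real) \<Rightarrow> real ^ 'd \<Rightarrow> real ^ 'd" where
  "grad v \<xi> = (\<chi> \<nu>. frechet_derivative v (at \<xi>) (axis \<nu> 1))"

definition divergence :: "(real ^ 'd \<Rightarrow> real ^ 'd) \<Rightarrow> real ^ 'd \<Rightarrow> real" where
  "divergence F \<xi> = (\<Sum>\<nu>\<in>UNIV. frechet_derivative F (at \<xi>) (axis \<nu> 1) $ \<nu>)"

definition ref_inner :: "(real ^ 'd \<Rightarrow> real) \<Rightarrow> (real ^ 'd \<Rightarrow> real) \<Rightarrow> real" where
  "ref_inner p q = (LINT \<xi>:ref_simplex|lborel. p \<xi> * q \<xi>)"

text \<open>
  For a unit vector \<open>n\<close> this is the \<open>(d-1)\<close>-dimensional Lebesgue measure on the hyperplane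
  \<open>n \<bullet> x = b\<close>: the image of Lebesgue measure on the adjacent slab of thickness 1
  under orthogonal projection onto the hyperplane.
\<close>

definition hyperplane_measure :: "real ^ 'd \<Rightarrow> real \<Rightarrow> (real ^ 'd) measure" where
  "hyperplane_measure n b =
     distr (restrict_space lborel {x. b \<le> n \<bullet> x \<and> n \<bullet> x \<le> b + 1}) borel
       (\<lambda>x. x - (n \<bullet> x - b) *\<^sub>R n)"

text \<open>
  The \<open>d + 1\<close> vertices of a simplex are indexed by \<open>'d option\<close>: \<open>None\<close> is the vertex
  \<open>v\<^sub>1\<close> (the origin, for the reference simplex) and \<open>Some \<nu>\<close> the vertex mapped from the
  \<open>\<nu>\<close>-th unit vector. A facet carries the index of the opposite vertex.
\<close>

fun facet_normal :: "'d option \<Rightarrow> real ^ 'd" where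
  "facet_normal None = (\<chi> i. 1 / sqrt (real CARD('d)))"
| "facet_normal (Some \<nu>) = - axis \<nu> 1"

fun facet_offset :: "'d option \<Rightarrow> real" where
  "facet_offset (None :: 'd option) = 1 / sqrt (real CARD('d))"
| "facet_offset (Some \<nu>) = 0"

definition ref_facet :: "'d option \<Rightarrow> (real ^ 'd) set" where
  "ref_facet l = {\<xi> \<in> ref_simplex. facet_normal l \<bullet> \<xi> = facet_offset l}"

definition ref_boundary_integral :: "('d option \<Rightarrow> real ^ 'd \<Rightarrow> real) \<Rightarrow> real" where
  "ref_boundary_integral \<phi> = (\<Sum>l\<in>UNIV. LINT \<xi>:ref_facet l|
      hyperplane_measure (facet_normal l) (facet_offset l). \<phi> l \<xi>)"


section \<open>Moving simplicial meshes\<close>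

definition cell_matrix :: "('d option \<Rightarrow> real ^ 'd) \<Rightarrow> real ^ 'd ^ 'd" where
  "cell_matrix v = (\<chi> i \<nu>. (v (Some \<nu>) - v None) $ i)"

definition cell_map :: "('d option \<Rightarrow> real ^ 'd) \<Rightarrow> real ^ 'd \<Rightarrow> real ^ 'd" where
  "cell_map v \<xi> = cell_matrix v *v \<xi> + v None"

definition cell :: "('d option \<Rightarrow> real ^ 'd) \<Rightarrow> (real ^ 'd) set" where
  "cell v = interior (convex hull range v)"

definition inradius :: "(real ^ 'd) set \<Rightarrow> real" where
  "inradius S = Sup {r. \<exists>a. ball a r \<subseteq> S}"

text \<open>
  \<open>tlev n\<close> is the \<open>n\<close>-th time level and \<open>vert n K\<close> lists the vertices of the cell \<open>K\<close> at that
  level. The cells are labels, shared by all time levels. Since the vertex trajectories have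
  kinks at the time levels, every time-dependent quantity carries the number \<open>n\<close> of the slab
  \<open>{tlev n..tlev (Suc n)}\<close> on which it is considered.
\<close>

definition vert_at :: "(nat \<Rightarrow> real) \<Rightarrow> (nat \<Rightarrow> 'c \<Rightarrow> 'd option \<Rightarrow> real ^ 'd) \<Rightarrow>
    nat \<Rightarrow> real \<Rightarrow> 'c \<Rightarrow> 'd option \<Rightarrow> real ^ 'd" where
  "vert_at tlev vert n t K l =
     vert n K l + ((t - tlev n) / (tlev (Suc n) - tlev n)) *\<^sub>R (vert (Suc n) K l - vert n K l)"

definition grid_velocity :: "(nat \<Rightarrow> real) \<Rightarrow> (nat \<Rightarrow> 'c \<Rightarrow> 'd option \<Rightarrow> real ^ 'd) \<Rightarrow>
    nat \<Rightarrow> real \<Rightarrow> 'c \<Rightarrow> real ^ 'd \<Rightarrow> real ^ 'd" where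
  "grid_velocity tlev vert n t K \<xi> =
     vector_derivative (\<lambda>\<theta>. cell_map (vert_at tlev vert n \<theta> K) \<xi>)
       (at t within {tlev n..tlev (Suc n)})"

definition mesh_size :: "nat \<Rightarrow> (nat \<Rightarrow> real) \<Rightarrow> 'c set \<Rightarrow>
    (nat \<Rightarrow> 'c \<Rightarrow> 'd option \<Rightarrow> real ^ 'd) \<Rightarrow> real" where
  "mesh_size N tlev cells vert =
     Sup {diameter (cell (vert_at tlev vert n t K)) | n t K.
            n < N \<and> t \<in> {tlev n..tlev (Suc n)} \<and> K \<in> cells}"

definition regular_mesh :: "(real ^ 'd) set \<Rightarrow> 'c set \<Rightarrow> ('c \<Rightarrow> 'd option \<Rightarrow> real ^ 'd) \<Rightarrow> bool"
  where
  "regular_mesh \<Omega> cells V \<longleftrightarrow>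
     finite cells \<and>
     inj_on (\<lambda>K. convex hull range (V K)) cells \<and>
     triangulation ((\<lambda>K. convex hull range (V K)) ` cells) \<and>
     (\<forall>K\<in>cells. 0 < det (cell_matrix (V K))) \<and>
     closure \<Omega> = (\<Union>K\<in>cells. closure (cell (V K)))"

definition same_topology :: "'c set \<Rightarrow> ('c \<Rightarrow> 'd option \<Rightarrow> real ^ 'd) \<Rightarrow>
    ('c \<Rightarrow> 'd option \<Rightarrow> real ^ 'd) \<Rightarrow> bool" where
  "same_topology cells V W \<longleftrightarrow>
     (\<forall>K\<in>cells. \<forall>L\<in>cells. \<forall>l m. V K l = V L m \<longleftrightarrow> W K l = W L m)"

definition moving_mesh :: "(real ^ 'd) set \<Rightarrow> real \<Rightarrow> nat \<Rightarrow> (nat \<Rightarrow> real) \<Rightarrow> 'c set \<Rightarrow>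
    (nat \<Rightarrow> 'c \<Rightarrow> 'd option \<Rightarrow> real ^ 'd) \<Rightarrow> real \<Rightarrow> real \<Rightarrow> bool" where
  "moving_mesh \<Omega> T N tlev cells vert \<kappa> \<tau> \<longleftrightarrow>
     open \<Omega> \<and> convex \<Omega> \<and> polyhedron (closure \<Omega>) \<and>
     tlev 0 = 0 \<and> tlev N = T \<and> (\<forall>n<N. tlev n < tlev (Suc n)) \<and>
     (\<forall>n\<le>N. regular_mesh \<Omega> cells (vert n)) \<and>
     (\<forall>n<N. same_topology cells (vert n) (vert (Suc n))) \<and>
     0 < \<kappa> \<and> 0 < \<tau> \<and>
     (\<forall>n<N. \<forall>t\<in>{tlev n..tlev (Suc n)}.
        closure \<Omega> = (\<Union>K\<in>cells. closure (cell (vert_at tlev vert n t K))) \<and>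
        (\<forall>K\<in>cells. 0 < det (cell_matrix (vert_at tlev vert n t K))) \<and>
        (\<forall>K\<in>cells.
           diameter (cell (vert_at tlev vert n t K)) \<le> \<kappa> * inradius (cell (vert_at tlev vert n t K)) \<and>
           mesh_size N tlev cells vert \<le> \<tau> * diameter (cell (vert_at tlev vert n t K))))"

text \<open>
  Elements of the piecewise polynomial space. As they belong to \<open>L\<^sup>2\<close>, only the values in the
  open cells matter; \<open>is_pull_back\<close> additionally fixes the convention that at a point of an
  interface the function takes one of its one-sided values.
\<close>

definition dg_space :: "(real ^ 'd) set \<Rightarrow> 'c set \<Rightarrow> ('c \<Rightarrow> 'd option \<Rightarrow> real ^ 'd) \<Rightarrow> nat \<Rightarrow>
    (real ^ 'd \<Rightarrow> real) set" where
  "dg_space \<Omega> cells V k =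
     {v. v \<in> borel_measurable (lebesgue_on \<Omega>) \<and> integrable (lebesgue_on \<Omega>) (\<lambda>x. (v x)\<^sup>2) \<and>
         (\<forall>K\<in>cells. \<exists>p\<in>poly_space k. \<forall>\<xi>\<in>interior ref_simplex. v (cell_map (V K) \<xi>) = p \<xi>)}"

definition is_pull_back :: "(real ^ 'd) set \<Rightarrow> 'c set \<Rightarrow> ('c \<Rightarrow> 'd option \<Rightarrow> real ^ 'd) \<Rightarrow>
    (real ^ 'd \<Rightarrow> real) \<Rightarrow> ('c \<Rightarrow> real ^ 'd \<Rightarrow> real) \<Rightarrow> bool" where
  "is_pull_back \<Omega> cells V v p \<longleftrightarrow>
     (\<forall>K\<in>cells. \<forall>\<xi>\<in>interior ref_simplex. v (cell_map (V K) \<xi>) = p K \<xi>) \<and>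
     (\<forall>x\<in>\<Omega>. \<exists>K\<in>cells. \<exists>\<xi>\<in>ref_simplex. x = cell_map (V K) \<xi> \<and> v x = p K \<xi>)"


section \<open>Fluxes and boundary conditions\<close>

definition ale_flux :: "(real \<Rightarrow> real ^ 'd) \<Rightarrow> real ^ 'd \<Rightarrow> real \<Rightarrow> real ^ 'd" where
  "ale_flux f w u = f u - u *\<^sub>R w"

definition numerical_flux :: "(real \<Rightarrow> real ^ 'd) \<Rightarrow>
    (real ^ 'd \<Rightarrow> real \<Rightarrow> real \<Rightarrow> real ^ 'd \<Rightarrow> real) \<Rightarrow> bool" where
  "numerical_flux f ghat \<longleftrightarrow>
     (\<forall>w u n. ghat w u u n = ale_flux f w u \<bullet> n) \<and>
     (\<forall>w u2 n. mono (\<lambda>u1. ghat w u1 u2 n) \<and> (\<exists>C. C-lipschitz_on UNIV (\<lambda>u1. ghat w u1 u2 n))) \<and>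
     (\<forall>w u1 n. antimono (\<lambda>u2. ghat w u1 u2 n) \<and> (\<exists>C. C-lipschitz_on UNIV (\<lambda>u2. ghat w u1 u2 n))) \<and>
     (\<forall>w u1 u2 n. ghat w u1 u2 n = - ghat w u2 u1 (- n))"

text \<open>
  A boundary condition is an operator \<open>bc t u K \<xi>\<close> giving the exterior state on the boundary of
  the domain, at the point with reference coordinate \<open>\<xi>\<close> of the cell \<open>K\<close>, for the discrete
  function with pull-backs \<open>u\<close> (periodic, outflow, ...). It is suitable if it
  is compatible with constant states.
\<close>

definition suitable_bc :: "real \<Rightarrow> 'c set \<Rightarrow>
    (real \<Rightarrow> ('c \<Rightarrow> real ^ 'd \<Rightarrow> real) \<Rightarrow> 'c \<Rightarrow> real ^ 'd \<Rightarrow> real) \<Rightarrow> bool" where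
  "suitable_bc T cells bc \<longleftrightarrow>
     (\<forall>t\<in>{0..T}. \<forall>c u. (\<forall>L\<in>cells. \<forall>\<xi>\<in>ref_simplex. u L \<xi> = c) \<longrightarrow>
        (\<forall>K\<in>cells. \<forall>\<xi>\<in>frontier ref_simplex. bc t u K \<xi> = c))"

text \<open>
  Exterior trace on the facet \<open>l\<close> of the cell \<open>K\<close>. The cell on the other side, if any, is
  determined by the mesh topology: it contains all vertices of \<open>K\<close> except \<open>l\<close>.
\<close>

definition neighbour :: "'c set \<Rightarrow> ('c \<Rightarrow> 'd option \<Rightarrow> real ^ 'd) \<Rightarrow> 'c \<Rightarrow> 'd option \<Rightarrow> 'c \<Rightarrow> bool"
  where
  "neighbour cells V K l L \<longleftrightarrow> L \<in> cells \<and> L \<noteq> K \<and> V K ` (UNIV - {l}) \<subseteq> range (V L)"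

definition ext_trace :: "(nat \<Rightarrow> real) \<Rightarrow> 'c set \<Rightarrow> (nat \<Rightarrow> 'c \<Rightarrow> 'd option \<Rightarrow> real ^ 'd) \<Rightarrow>
    (real \<Rightarrow> ('c \<Rightarrow> real ^ 'd \<Rightarrow> real) \<Rightarrow> 'c \<Rightarrow> real ^ 'd \<Rightarrow> real) \<Rightarrow>
    nat \<Rightarrow> real \<Rightarrow> ('c \<Rightarrow> real ^ 'd \<Rightarrow> real) \<Rightarrow> 'c \<Rightarrow> 'd option \<Rightarrow> real ^ 'd \<Rightarrow> real" where
  "ext_trace tlev cells vert bc n t u K l \<xi> =
     (if \<exists>L. neighbour cells (vert n) K l L
      then let L = (SOME L. neighbour cells (vert n) K l L);
               V = vert_at tlev vert n t
           in u L (matrix_inv (cell_matrix (V L)) *v (cell_map (V K) \<xi> - V L None))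
      else bc t u K \<xi>)"

definition ale_form :: "(nat \<Rightarrow> real) \<Rightarrow> 'c set \<Rightarrow> (nat \<Rightarrow> 'c \<Rightarrow> 'd option \<Rightarrow> real ^ 'd) \<Rightarrow>
    (real \<Rightarrow> real ^ 'd) \<Rightarrow> (real ^ 'd \<Rightarrow> real \<Rightarrow> real \<Rightarrow> real ^ 'd \<Rightarrow> real) \<Rightarrow>
    (real \<Rightarrow> ('c \<Rightarrow> real ^ 'd \<Rightarrow> real) \<Rightarrow> 'c \<Rightarrow> real ^ 'd \<Rightarrow> real) \<Rightarrow>
    nat \<Rightarrow> 'c \<Rightarrow> ('c \<Rightarrow> real ^ 'd \<Rightarrow> real) \<Rightarrow> (real ^ 'd \<Rightarrow> real) \<Rightarrow> real \<Rightarrow> real \<Rightarrow> real" where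
  "ale_form tlev cells vert f ghat bc n K u v J t =
     (let A = cell_matrix (vert_at tlev vert n t K); w = grid_velocity tlev vert n t K in
        (LINT \<xi>:ref_simplex|lborel.
            (J *\<^sub>R (matrix_inv A *v ale_flux f (w \<xi>) (u K \<xi>))) \<bullet> grad v \<xi>)
      - ref_boundary_integral (\<lambda>l \<xi>.
            ghat (w \<xi>) (u K \<xi>) (ext_trace tlev cells vert bc n t u K l \<xi>)
              (J *\<^sub>R (transpose (matrix_inv A) *v facet_normal l)) * v \<xi>))"


section \<open>TVD Runge--Kutta methods\<close>

definition tvd_rk :: "nat \<Rightarrow> (nat \<Rightarrow> nat \<Rightarrow> real) \<Rightarrow> (nat \<Rightarrow> nat \<Rightarrow> real) \<Rightarrow> (nat \<Rightarrow> real) \<Rightarrow> bool"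
  where
  "tvd_rk s \<alpha> \<beta> \<gamma> \<longleftrightarrow>
     (\<forall>j<s. 0 \<le> \<gamma> j \<and> \<gamma> j \<le> 1) \<and>
     (\<forall>i\<in>{1..s}. (\<forall>j<i. 0 \<le> \<alpha> i j \<and> 0 \<le> \<beta> i j \<and> (\<alpha> i j = 0 \<longrightarrow> \<beta> i j = 0)) \<and>
        (\<Sum>j<i. \<alpha> i j) = 1)"

text \<open>
  The order is that of the local error for all smooth systems \<open>u' = q(u,t)\<close> of an arbitrary
  number \<open>m\<close> of equations. To quantify over \<open>m\<close>, vectors are functions on \<open>nat\<close> of which only
  the first \<open>m\<close> components are relevant. \<open>Cr m r F\<close>: the partial derivatives of \<open>F\<close> up to order
  \<open>r\<close> in the first \<open>m\<close> variables exist and are continuous.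
\<close>

fun Cr :: "nat \<Rightarrow> nat \<Rightarrow> ((nat \<Rightarrow> real) \<Rightarrow> real) \<Rightarrow> bool" where
  "Cr m 0 F \<longleftrightarrow> continuous_on UNIV F"
| "Cr m (Suc r) F \<longleftrightarrow> continuous_on UNIV F \<and>
     (\<forall>i<m. \<exists>G. (\<forall>z. ((\<lambda>y. F (z(i := y))) has_real_derivative G z) (at (z i))) \<and> Cr m r G)"

text \<open>In the smoothness condition, component \<open>m\<close> of the argument plays the role of time.\<close>

definition smooth_system :: "nat \<Rightarrow> ((nat \<Rightarrow> real) \<Rightarrow> real \<Rightarrow> nat \<Rightarrow> real) \<Rightarrow> bool" where
  "smooth_system m q \<longleftrightarrow>
     (\<forall>y y' t. (\<forall>k<m. y k = y' k) \<longrightarrow> (\<forall>k<m. q y t k = q y' t k)) \<and>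
     (\<forall>k<m. \<forall>r. Cr (Suc m) r (\<lambda>z. q z (z m) k))"

fun rk_stage :: "(nat \<Rightarrow> nat \<Rightarrow> real) \<Rightarrow> (nat \<Rightarrow> nat \<Rightarrow> real) \<Rightarrow> (nat \<Rightarrow> real) \<Rightarrow>
    ((nat \<Rightarrow> real) \<Rightarrow> real \<Rightarrow> nat \<Rightarrow> real) \<Rightarrow> real \<Rightarrow> real \<Rightarrow> (nat \<Rightarrow> real) \<Rightarrow>
    nat \<Rightarrow> nat \<Rightarrow> real" where
  "rk_stage \<alpha> \<beta> \<gamma> q t\<^sub>0 dt u\<^sub>0 i =
     (if i = 0 then u\<^sub>0
      else (\<lambda>k. \<Sum>j<i. \<alpha> i j * rk_stage \<alpha> \<beta> \<gamma> q t\<^sub>0 dt u\<^sub>0 j k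
                     + dt * \<beta> i j * q (rk_stage \<alpha> \<beta> \<gamma> q t\<^sub>0 dt u\<^sub>0 j) (t\<^sub>0 + \<gamma> j * dt) k))"

declare rk_stage.simps [simp del]

definition rk_order_ge :: "nat \<Rightarrow> (nat \<Rightarrow> nat \<Rightarrow> real) \<Rightarrow> (nat \<Rightarrow> nat \<Rightarrow> real) \<Rightarrow> (nat \<Rightarrow> real) \<Rightarrow>
    nat \<Rightarrow> bool" where
  "rk_order_ge s \<alpha> \<beta> \<gamma> p \<longleftrightarrow>
     (\<forall>m q t\<^sub>0 \<theta> u. smooth_system m q \<and> 0 < \<theta> \<and>
        (\<forall>t\<in>{t\<^sub>0..t\<^sub>0 + \<theta>}. \<forall>k<m.
           ((\<lambda>r. u r k) has_real_derivative q (u t) t k) (at t within {t\<^sub>0..t\<^sub>0 + \<theta>})) \<longrightarrow>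
        (\<exists>C. \<exists>\<delta>>0. \<forall>dt. 0 < dt \<and> dt < \<delta> \<longrightarrow>
           (\<forall>k<m. \<bar>rk_stage \<alpha> \<beta> \<gamma> q t\<^sub>0 dt (u t\<^sub>0) s k - u (t\<^sub>0 + dt) k\<bar> \<le> C * dt ^ (p + 1))))"


section \<open>Fully-discrete method\<close>

text \<open>
  The stage metric terms of the step from \<open>tlev n\<close> to \<open>tlev (Suc n)\<close>. The divergence
  is constant on the reference simplex, since the grid velocity is affine in \<open>\<xi>\<close>; it is
  evaluated at the origin.
\<close>

fun stage_metric :: "(nat \<Rightarrow> nat \<Rightarrow> real) \<Rightarrow> (nat \<Rightarrow> nat \<Rightarrow> real) \<Rightarrow> (nat \<Rightarrow> real) \<Rightarrow>
    (nat \<Rightarrow> real) \<Rightarrow> (nat \<Rightarrow> 'c \<Rightarrow> 'd::finite option \<Rightarrow> real ^ 'd) \<Rightarrow> nat \<Rightarrow> 'c \<Rightarrow> nat \<Rightarrow> real" where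
  "stage_metric \<alpha> \<beta> \<gamma> tlev vert n K i =
     (if i = 0 then det (cell_matrix (vert n K))
      else \<Sum>j<i.
        let dt = tlev (Suc n) - tlev n; t = tlev n + \<gamma> j * dt;
            A = cell_matrix (vert_at tlev vert n t K) in
        \<alpha> i j * stage_metric \<alpha> \<beta> \<gamma> tlev vert n K j
        + \<beta> i j * dt * divergence (\<lambda>\<xi>. matrix_inv A *v grid_velocity tlev vert n t K \<xi>) 0
            * stage_metric \<alpha> \<beta> \<gamma> tlev vert n K j)"

declare stage_metric.simps [simp del]

text \<open>
  \<open>U n K\<close> is the pull-back of the discrete solution at time level \<open>n\<close> and \<open>S n i K\<close> the
  \<open>i\<close>-th stage function of the following step. The test functions run through
  \<open>poly_space k\<close>, the space of pull-backs to one cell of the elements of the discrete space.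
\<close>

definition ale_dg_method :: "nat \<Rightarrow> (nat \<Rightarrow> nat \<Rightarrow> real) \<Rightarrow> (nat \<Rightarrow> nat \<Rightarrow> real) \<Rightarrow> (nat \<Rightarrow> real) \<Rightarrow>
    nat \<Rightarrow> (nat \<Rightarrow> real) \<Rightarrow> 'c set \<Rightarrow> (nat \<Rightarrow> 'c \<Rightarrow> 'd::finite option \<Rightarrow> real ^ 'd) \<Rightarrow> nat \<Rightarrow>
    (real \<Rightarrow> real ^ 'd) \<Rightarrow> (real ^ 'd \<Rightarrow> real \<Rightarrow> real \<Rightarrow> real ^ 'd \<Rightarrow> real) \<Rightarrow>
    (real \<Rightarrow> ('c \<Rightarrow> real ^ 'd \<Rightarrow> real) \<Rightarrow> 'c \<Rightarrow> real ^ 'd \<Rightarrow> real) \<Rightarrow>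
    (nat \<Rightarrow> 'c \<Rightarrow> real ^ 'd \<Rightarrow> real) \<Rightarrow> (nat \<Rightarrow> nat \<Rightarrow> 'c \<Rightarrow> real ^ 'd \<Rightarrow> real) \<Rightarrow> bool" where
  "ale_dg_method s \<alpha> \<beta> \<gamma> N tlev cells vert k f ghat bc U S \<longleftrightarrow>
     (\<forall>n\<le>N. \<forall>K\<in>cells. U n K \<in> poly_space k) \<and>
     (\<forall>n<N. \<forall>K\<in>cells. \<forall>i\<le>s. S n i K \<in> poly_space k) \<and>
     (\<forall>n<N. \<forall>K\<in>cells. \<forall>v\<in>poly_space k.
        let J = stage_metric \<alpha> \<beta> \<gamma> tlev vert n K; dt = tlev (Suc n) - tlev n in
        ref_inner (\<lambda>\<xi>. J 0 * S n 0 K \<xi>) v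
          = ref_inner (\<lambda>\<xi>. det (cell_matrix (vert n K)) * U n K \<xi>) v \<and>
        (\<forall>i\<in>{1..s}.
           ref_inner (\<lambda>\<xi>. J i * S n i K \<xi>) v
             = (\<Sum>j<i. \<alpha> i j * ref_inner (\<lambda>\<xi>. J j * S n j K \<xi>) v)
             + (\<Sum>j<i. \<beta> i j * dt *
                  ale_form tlev cells vert f ghat bc n K (S n j) v (J j) (tlev n + \<gamma> j * dt))) \<and>
        ref_inner (\<lambda>\<xi>. J s * U (Suc n) K \<xi>) v = ref_inner (\<lambda>\<xi>. J s * S n s K \<xi>) v)"

end

theory Submission
  imports Defs
begin

text \<open>
  For a constant state \<open>c\<close> consistency turns the numerical flux into the normal component of the
  physical one, and the flux is affine on the reference simplex. Integration by parts therefore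
  reduces the spatial form, tested with \<open>v\<close>, to \<open>c\<close> times the right-hand side of the differential
  equation for the metric term times the integral of \<open>v\<close>. So \<open>J\<^sub>i c\<close> obeys the same stage
  recursion as \<open>J\<^sub>i u\<^sub>i\<close>, and since \<open>J\<^sub>i \<noteq> 0\<close> every stage equals \<open>c\<close>.

  The divergence theorem on the simplex is obtained coordinatewise: averaging over the translates
  \<open>x + s e\<close> replaces Fubini's theorem in coordinates and reduces it to the fundamental theorem of
  calculus on the chords parallel to \<open>e\<close>.
\<close>

section \<open>Integration along parallel lines\<close>

lemma nn_integral_lborel_translate:
  fixes c :: "'a::euclidean_space"
  assumes [measurable]: "g \<in> borel_measurable borel"
  shows "(\<integral>\<^sup>+x. g (x + c) \<partial>lborel) = (\<integral>\<^sup>+x. g x \<partial>lborel)"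
proof -
  have "(\<integral>\<^sup>+x. g x \<partial>lborel) = (\<integral>\<^sup>+x. g x \<partial>distr lborel borel ((+) c))"
    by (simp add: lborel_distr_plus)
  also have "\<dots> = (\<integral>\<^sup>+x. g (x + c) \<partial>lborel)"
    by (subst nn_integral_distr) (simp_all add: add.commute)
  finally show ?thesis ..
qed

text \<open>Tonelli swaps the two integrals, translation invariance moves the shift from
  \<open>g\<close> to \<open>\<psi>\<close>, and the inner integral left over is that of
  \<open>\<psi>\<close> along a line run backwards, which is again 1.\<close>

lemma nn_integral_line_average:
  fixes e :: "'a::euclidean_space" and g \<psi> :: "'a \<Rightarrow> ennreal"
  assumes [measurable]: "g \<in> borel_measurable borel" "\<psi> \<in> borel_measurable borel"
    and \<psi>: "\<And>x. (\<integral>\<^sup>+s. \<psi> (x + s *\<^sub>R e) \<partial>lborel) = 1"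
  shows "(\<integral>\<^sup>+x. \<psi> x * (\<integral>\<^sup>+s. g (x + s *\<^sub>R e) \<partial>lborel) \<partial>lborel) = (\<integral>\<^sup>+x. g x \<partial>lborel)"
proof -
  have reflect: "(\<integral>\<^sup>+s. \<psi> (x - s *\<^sub>R e) \<partial>lborel) = 1" for x
    using \<psi>[of x] by (subst (asm) nn_integral_real_affine[where c = "-1" and t = 0]) auto
  have "(\<integral>\<^sup>+x. \<psi> x * (\<integral>\<^sup>+s. g (x + s *\<^sub>R e) \<partial>lborel) \<partial>lborel)
      = (\<integral>\<^sup>+x. (\<integral>\<^sup>+s. \<psi> x * g (x + s *\<^sub>R e) \<partial>lborel) \<partial>lborel)"
    by (intro nn_integral_cong nn_integral_cmult[symmetric]) auto
  also have "\<dots> = (\<integral>\<^sup>+s. (\<integral>\<^sup>+x. \<psi> x * g (x + s *\<^sub>R e) \<partial>lborel) \<partial>lborel)"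
    by (rule lborel_pair.Fubini'[symmetric]) measurable
  also have "\<dots> = (\<integral>\<^sup>+s. (\<integral>\<^sup>+x. \<psi> (x - s *\<^sub>R e) * g x \<partial>lborel) \<partial>lborel)"
  proof (rule nn_integral_cong)
    fix s :: real
    show "(\<integral>\<^sup>+x. \<psi> x * g (x + s *\<^sub>R e) \<partial>lborel) = (\<integral>\<^sup>+x. \<psi> (x - s *\<^sub>R e) * g x \<partial>lborel)"
      using nn_integral_lborel_translate[of "\<lambda>x. \<psi> (x - s *\<^sub>R e) * g x" "s *\<^sub>R e"] by simp
  qed
  also have "\<dots> = (\<integral>\<^sup>+x. (\<integral>\<^sup>+s. \<psi> (x - s *\<^sub>R e) * g x \<partial>lborel) \<partial>lborel)"
    by (rule lborel_pair.Fubini') measurable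
  also have "\<dots> = (\<integral>\<^sup>+x. g x \<partial>lborel)"
    by (intro nn_integral_cong) (simp add: nn_integral_multc reflect)
  finally show ?thesis .
qed

text \<open>A normalised weight samples each line parallel to \<open>e\<close> with total mass 1.
  Averaging \<open>\<psi> * H\<close> with the weight \<open>\<psi>'\<close> shows that the choice
  of weight is immaterial once \<open>H\<close> is constant on the lines.\<close>

lemma nn_integral_line_invariant:
  fixes e :: "'a::euclidean_space" and H \<psi> \<psi>' :: "'a \<Rightarrow> ennreal"
  assumes [measurable]: "H \<in> borel_measurable borel" "\<psi> \<in> borel_measurable borel"
      "\<psi>' \<in> borel_measurable borel"
    and H: "\<And>x s. H (x + s *\<^sub>R e) = H x"
    and \<psi>: "\<And>x. (\<integral>\<^sup>+s. \<psi> (x + s *\<^sub>R e) \<partial>lborel) = 1"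
    and \<psi>': "\<And>x. (\<integral>\<^sup>+s. \<psi>' (x + s *\<^sub>R e) \<partial>lborel) = 1"
  shows "(\<integral>\<^sup>+x. \<psi> x * H x \<partial>lborel) = (\<integral>\<^sup>+x. \<psi>' x * H x \<partial>lborel)"
proof -
  have "(\<integral>\<^sup>+x. \<psi> x * H x \<partial>lborel)
      = (\<integral>\<^sup>+x. \<psi>' x * (\<integral>\<^sup>+s. \<psi> (x + s *\<^sub>R e) * H (x + s *\<^sub>R e) \<partial>lborel) \<partial>lborel)"
    by (rule nn_integral_line_average[symmetric]) (use \<psi>' in measurable)
  also have "\<dots> = (\<integral>\<^sup>+x. \<psi>' x * H x \<partial>lborel)"
    by (intro nn_integral_cong) (simp add: H nn_integral_multc \<psi>)
  finally show ?thesis .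
qed

section \<open>Slabs, shears and projections onto hyperplanes\<close>

definition slab :: "'a::euclidean_space \<Rightarrow> real \<Rightarrow> 'a set" where
  "slab a b = {x. b \<le> a \<bullet> x \<and> a \<bullet> x \<le> b + 1}"

lemma closed_slab: "closed (slab a b)"
  unfolding slab_def by (intro closed_Collect_conj closed_Collect_le continuous_intros)

lemma slab_measurable [measurable]: "slab a b \<in> sets borel"
  by (rule borel_closed[OF closed_slab])

text \<open>Every line parallel to \<open>e\<close> crosses the slab in a parameter interval of
  length \<open>1 / (a \<bullet> e)\<close>, so slabs supply the normalised weights for averaging
  over lines.\<close>

lemma slab_line_weight:
  fixes a e :: "'a::euclidean_space"
  assumes "0 < a \<bullet> e"
  shows "(\<integral>\<^sup>+s. ennreal (a \<bullet> e) * indicator (slab a b) (x + s *\<^sub>R e) \<partial>lborel) = 1"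
proof -
  have "indicator (slab a b) (x + s *\<^sub>R e)
      = (indicator {(b - a \<bullet> x) / (a \<bullet> e)..(b + 1 - a \<bullet> x) / (a \<bullet> e)} s :: ennreal)" for s
    using assms by (auto simp: slab_def indicator_def inner_add_right field_simps)
  then have "(\<integral>\<^sup>+s. ennreal (a \<bullet> e) * indicator (slab a b) (x + s *\<^sub>R e) \<partial>lborel)
      = ennreal (a \<bullet> e) * emeasure lborel {(b - a \<bullet> x) / (a \<bullet> e)..(b + 1 - a \<bullet> x) / (a \<bullet> e)}"
    by (simp add: nn_integral_cmult)
  also have "\<dots> = ennreal (a \<bullet> e) * ennreal (1 / (a \<bullet> e))"
    using assms by (subst emeasure_lborel_Icc) (auto simp: field_simps simp flip: diff_divide_distrib)
  also have "\<dots> = 1"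
    using assms by (simp flip: ennreal_mult)
  finally show ?thesis .
qed

text \<open>Since \<open>r\<close> is constant along \<open>w\<close>, the map is a mere translation
  on each line parallel to \<open>w\<close>; averaging over these lines reduces the claim to
  translation invariance on the real line.\<close>

lemma nn_integral_shear:
  fixes w :: "'a::euclidean_space" and g :: "'a \<Rightarrow> ennreal"
  assumes [measurable]: "g \<in> borel_measurable borel" "r \<in> borel_measurable borel"
    and r: "\<And>x s. r (x + s *\<^sub>R w) = r x"
  shows "(\<integral>\<^sup>+x. g (x + r x *\<^sub>R w) \<partial>lborel) = (\<integral>\<^sup>+x. g x \<partial>lborel)"
proof (cases "w = 0")
  case False
  \<comment> \<open>Any slab transversal to \<open>w\<close> would do; with \<open>w\<close> as its
    own normal the factor is \<open>w \<bullet> w\<close>, positive because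
    \<open>w \<noteq> 0\<close>.\<close>
  define \<psi> where "\<psi> x = ennreal (w \<bullet> w) * indicator (slab w 0) x" for x
  have [measurable]: "\<psi> \<in> borel_measurable borel"
    unfolding \<psi>_def by measurable
  have \<psi>: "(\<integral>\<^sup>+s. \<psi> (x + s *\<^sub>R w) \<partial>lborel) = 1" for x
    unfolding \<psi>_def by (rule slab_line_weight) (use False in simp)
  have "(\<integral>\<^sup>+x. g (x + r x *\<^sub>R w) \<partial>lborel)
      = (\<integral>\<^sup>+x. \<psi> x * (\<integral>\<^sup>+s. g (x + s *\<^sub>R w + r (x + s *\<^sub>R w) *\<^sub>R w) \<partial>lborel) \<partial>lborel)"
    by (rule nn_integral_line_average[symmetric]) (use \<psi> in measurable)
  also have "\<dots> = (\<integral>\<^sup>+x. \<psi> x * (\<integral>\<^sup>+s. g (x + s *\<^sub>R w) \<partial>lborel) \<partial>lborel)"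
  proof (rule nn_integral_cong)
    fix x :: 'a
    have "(\<integral>\<^sup>+s. g (x + s *\<^sub>R w + r (x + s *\<^sub>R w) *\<^sub>R w) \<partial>lborel)
        = (\<integral>\<^sup>+s. g (x + (s + r x) *\<^sub>R w) \<partial>lborel)"
      by (intro nn_integral_cong) (simp add: r algebra_simps)
    also have "\<dots> = (\<integral>\<^sup>+s. g (x + s *\<^sub>R w) \<partial>lborel)"
      by (rule nn_integral_lborel_translate[of "\<lambda>s. g (x + s *\<^sub>R w)"]) measurable
    finally show "\<psi> x * (\<integral>\<^sup>+s. g (x + s *\<^sub>R w + r (x + s *\<^sub>R w) *\<^sub>R w) \<partial>lborel)
        = \<psi> x * (\<integral>\<^sup>+s. g (x + s *\<^sub>R w) \<partial>lborel)"
      by (rule arg_cong)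
  qed
  also have "\<dots> = (\<integral>\<^sup>+x. g x \<partial>lborel)"
    by (rule nn_integral_line_average) (use \<psi> in measurable)
  finally show ?thesis .
qed simp

lemma nn_integral_distr_restrict_space:
  fixes F :: "'a::euclidean_space \<Rightarrow> ennreal"
  assumes [measurable]: "F \<in> borel_measurable borel" "P \<in> borel_measurable borel" "S \<in> sets borel"
  shows "(\<integral>\<^sup>+x. F x \<partial>distr (restrict_space lborel S) borel P)
    = (\<integral>\<^sup>+x. indicator S x * F (P x) \<partial>lborel)"
  by (subst nn_integral_distr)
     (auto simp: nn_integral_restrict_space mult.commute intro!: measurable_restrict_space1)

lemma
  fixes F :: "'a::euclidean_space \<Rightarrow> real"
  assumes [measurable]: "F \<in> borel_measurable borel" "P \<in> borel_measurable borel" "S \<in> sets borel"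
  shows integral_distr_restrict_space:
      "(LINT x|distr (restrict_space lborel S) borel P. F x) = (LINT x|lborel. indicator S x * F (P x))"
    and integrable_distr_restrict_space:
      "integrable (distr (restrict_space lborel S) borel P) F
        \<longleftrightarrow> integrable lborel (\<lambda>x. indicator S x * F (P x))"
proof -
  have [measurable]: "P \<in> measurable (restrict_space lborel S) borel"
    by (auto intro!: measurable_restrict_space1)
  show "(LINT x|distr (restrict_space lborel S) borel P. F x) = (LINT x|lborel. indicator S x * F (P x))"
    by (subst integral_distr) (auto simp: integral_restrict_space)
  show "integrable (distr (restrict_space lborel S) borel P) F
        \<longleftrightarrow> integrable lborel (\<lambda>x. indicator S x * F (P x))"
    by (subst integrable_distr_eq) (auto simp: integrable_restrict_space)
qed

lemma hyperplane_measure_eq: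
  "hyperplane_measure n b = distr (restrict_space lborel (slab n b)) borel (\<lambda>x. x - (n \<bullet> x - b) *\<^sub>R n)"
  by (simp add: hyperplane_measure_def slab_def)

lemma sets_hyperplane_measure [measurable_cong, simp]: "sets (hyperplane_measure n b) = sets borel"
  by (simp add: hyperplane_measure_def)

text \<open>
  The orthogonal projection onto a hyperplane and the projection along \<open>e\<close> differ by a shear,
  which preserves volume; after that the slab may be exchanged for any other slab because the
  integrand is constant along \<open>e\<close>.
\<close>

lemma distr_oblique_projection:
  fixes n e :: "real ^ 'd"
  assumes n: "n \<bullet> n = 1" and ne: "0 < n \<bullet> e" and ae: "a \<bullet> e = 1"
  shows "distr (restrict_space lborel (slab a c)) borel (\<lambda>x. x - ((n \<bullet> x - b) / (n \<bullet> e)) *\<^sub>R e)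
    = density (hyperplane_measure n b) (\<lambda>_. n \<bullet> e)" (is "distr ?M borel ?P = ?R")
proof (rule measure_eqI)
  fix A assume "A \<in> sets (distr ?M borel ?P)"
  then have [measurable]: "A \<in> sets borel" by simp
  \<comment> \<open>Scaled to normal component 1, \<open>e\<close> differs from \<open>n\<close> by
    the tangential vector \<open>w\<close>. Moving along \<open>w\<close> keeps
    \<open>n \<bullet> x\<close>, so the shift by \<open>(n \<bullet> x - b) *\<^sub>R w\<close> is
    a shear.\<close>
  define w where "w = e /\<^sub>R (n \<bullet> e) - n"
  have nw: "n \<bullet> w = 0"
    using n ne by (simp add: w_def inner_diff_right)
  have "emeasure (distr ?M borel ?P) A = (\<integral>\<^sup>+x. indicator A x \<partial>distr ?M borel ?P)"
    by simp
  also have "\<dots> = (\<integral>\<^sup>+x. ennreal (a \<bullet> e) * indicator (slab a c) x * indicator A (?P x) \<partial>lborel)"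
    by (subst nn_integral_distr_restrict_space) (auto simp: ae)
  also have "\<dots> = (\<integral>\<^sup>+x. ennreal (n \<bullet> e) * indicator (slab n b) x * indicator A (?P x) \<partial>lborel)"
  proof (rule nn_integral_line_invariant[where e = e])
    fix x s
    show "indicator A (?P (x + s *\<^sub>R e)) = (indicator A (?P x) :: ennreal)"
      using ne by (intro arg_cong[where f = "indicator A"])
        (simp add: inner_add_right add_divide_distrib diff_divide_distrib algebra_simps)
    show "(\<integral>\<^sup>+s. ennreal (a \<bullet> e) * indicator (slab a c) (x + s *\<^sub>R e) \<partial>lborel) = 1"
      by (rule slab_line_weight) (simp add: ae)
    show "(\<integral>\<^sup>+s. ennreal (n \<bullet> e) * indicator (slab n b) (x + s *\<^sub>R e) \<partial>lborel) = 1"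
      by (rule slab_line_weight) (rule ne)
  qed measurable
  also have "\<dots> = (\<integral>\<^sup>+x. ennreal (n \<bullet> e) * indicator (slab n b) (x + (n \<bullet> x - b) *\<^sub>R w)
      * indicator A (?P (x + (n \<bullet> x - b) *\<^sub>R w)) \<partial>lborel)"
    by (rule nn_integral_shear[symmetric]) (auto simp: inner_add_right nw)
  also have "\<dots> = (\<integral>\<^sup>+x. ennreal (n \<bullet> e) *
      (indicator (slab n b) x * indicator A (x - (n \<bullet> x - b) *\<^sub>R n)) \<partial>lborel)"
  proof (intro nn_integral_cong)
    fix x
    have "?P (x + (n \<bullet> x - b) *\<^sub>R w) = x - (n \<bullet> x - b) *\<^sub>R n"
      by (simp add: inner_add_right nw) (simp add: w_def algebra_simps divide_inverse)
    moreover have "indicator (slab n b) (x + (n \<bullet> x - b) *\<^sub>R w) = (indicator (slab n b) x :: ennreal)"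
      by (simp add: slab_def indicator_def inner_add_right nw)
    ultimately show "ennreal (n \<bullet> e) * indicator (slab n b) (x + (n \<bullet> x - b) *\<^sub>R w)
        * indicator A (?P (x + (n \<bullet> x - b) *\<^sub>R w))
      = ennreal (n \<bullet> e) * (indicator (slab n b) x * indicator A (x - (n \<bullet> x - b) *\<^sub>R n))"
      by (simp only: mult.assoc)
  qed
  also have "\<dots> = ennreal (n \<bullet> e) * emeasure (hyperplane_measure n b) A"
  proof -
    have "emeasure (hyperplane_measure n b) A = (\<integral>\<^sup>+x. indicator A x \<partial>hyperplane_measure n b)"
      by simp
    also have "\<dots> = (\<integral>\<^sup>+x. indicator (slab n b) x * indicator A (x - (n \<bullet> x - b) *\<^sub>R n) \<partial>lborel)"
      unfolding hyperplane_measure_eq by (subst nn_integral_distr_restrict_space) auto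
    finally show ?thesis
      by (simp add: nn_integral_cmult)
  qed
  also have "\<dots> = emeasure ?R A"
    by (simp add: emeasure_density nn_integral_cmult)
  finally show "emeasure (distr ?M borel ?P) A = emeasure ?R A" .
qed simp

text \<open>Signed functions require the averaging over lines as an identity between measures.\<close>

lemma lborel_line_average:
  fixes a e :: "'a::euclidean_space"
  assumes ae: "a \<bullet> e = 1"
  shows "(lborel :: 'a measure) = distr (density (lborel \<Otimes>\<^sub>M lborel) (\<lambda>(x, s :: real). indicator (slab a c) x))
    borel (\<lambda>(x, s). x + s *\<^sub>R e)" (is "_ = distr ?D borel ?T")
proof (rule measure_eqI)
  fix A :: "'a set" assume "A \<in> sets lborel"
  then have [measurable]: "A \<in> sets borel" by simp
  have "emeasure lborel A = (\<integral>\<^sup>+x. indicator A x \<partial>lborel)"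
    by simp
  also have "\<dots> = (\<integral>\<^sup>+x. (ennreal (a \<bullet> e) * indicator (slab a c) x) * (\<integral>\<^sup>+s. indicator A (x + s *\<^sub>R e) \<partial>lborel) \<partial>lborel)"
    by (rule nn_integral_line_average[symmetric]) (measurable, rule slab_line_weight, simp add: ae)
  also have "\<dots> = (\<integral>\<^sup>+x. (\<integral>\<^sup>+s. indicator (slab a c) x * indicator A (x + s *\<^sub>R e) \<partial>lborel) \<partial>lborel)"
    by (intro nn_integral_cong) (simp add: ae nn_integral_cmult)
  also have "\<dots> = (\<integral>\<^sup>+z. (case z of (x, s) \<Rightarrow> indicator (slab a c) x) * indicator A (?T z) \<partial>(lborel \<Otimes>\<^sub>M lborel))"
    by (subst lborel.nn_integral_fst[symmetric]) auto
  also have "\<dots> = (\<integral>\<^sup>+z. indicator A (?T z) \<partial>?D)"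
    by (subst nn_integral_density) auto
  also have "\<dots> = (\<integral>\<^sup>+x. indicator A x \<partial>distr ?D borel ?T)"
    by (subst nn_integral_distr) auto
  finally show "emeasure lborel A = emeasure (distr ?D borel ?T) A"
    by simp
qed simp

text \<open>The measure identity also transfers integrability of \<open>g\<close> to the product
  space, as Fubini demands. The condition \<open>a \<bullet> e = 1\<close> makes the bare indicator
  of the slab a normalised weight.\<close>

lemma integral_line_average:
  fixes a e :: "'a::euclidean_space" and g :: "'a \<Rightarrow> real"
  assumes ae: "a \<bullet> e = 1" and g: "integrable lborel g"
  shows "(LINT x|lborel. g x)
    = (LINT x|lborel. indicator (slab a c) x * (LINT s|lborel. g (x + s *\<^sub>R e)))"
proof -
  let ?D = "density (lborel \<Otimes>\<^sub>M lborel) (\<lambda>z. ennreal (indicator (slab a c) (fst z)))"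
  let ?T = "\<lambda>z :: 'a \<times> real. fst z + snd z *\<^sub>R e"
  have [measurable]: "g \<in> borel_measurable borel"
    using borel_measurable_integrable[OF g] by simp
  have D: "(lborel :: 'a measure) = distr ?D borel ?T"
    by (subst lborel_line_average[OF ae, of c])
      (simp add: case_prod_beta' ennreal_indicator cong: distr_cong)
  have *: "integrable (lborel \<Otimes>\<^sub>M lborel) (\<lambda>z. indicator (slab a c) (fst z) *\<^sub>R g (?T z))"
    using g by (subst (asm) D, subst (asm) integrable_distr_eq) (auto simp: integrable_density)
  have "(LINT x|lborel. g x) = (LINT z|?D. g (?T z))"
    by (subst D, subst integral_distr) auto
  also have "\<dots> = (LINT z|(lborel \<Otimes>\<^sub>M lborel). indicator (slab a c) (fst z) *\<^sub>R g (?T z))"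
    by (subst integral_density) auto
  also have "\<dots> = (LINT x|lborel. (LINT s|lborel. indicator (slab a c) x *\<^sub>R g (x + s *\<^sub>R e)))"
    using lborel_pair.integral_fst'[OF *] by simp
  finally show ?thesis
    by simp
qed

section \<open>Partial derivatives on the reference simplex\<close>

lemma ref_simplex_le_1:
  assumes "\<xi> \<in> ref_simplex" shows "\<xi> $ \<nu> \<le> 1"
proof -
  have "\<xi> $ \<nu> \<le> (\<Sum>\<mu>\<in>UNIV. \<xi> $ \<mu>)"
    using assms by (intro member_le_sum) (auto simp: ref_simplex_def)
  then show ?thesis
    using assms by (simp add: ref_simplex_def)
qed

lemma compact_ref_simplex: "compact ref_simplex"
proof -
  have "closed ref_simplex"
    unfolding ref_simplex_def
    by (intro closed_Collect_conj closed_Collect_all closed_Collect_le continuous_intros)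
  moreover have "ref_simplex \<subseteq> cbox 0 (\<chi> \<nu>. 1)"
    using ref_simplex_le_1 by (auto simp: cbox_def Basis_vec_def inner_axis ref_simplex_def)
  ultimately show ?thesis
    using bounded_cbox bounded_subset compact_eq_bounded_closed by blast
qed

lemma compact_ref_facet: "compact (ref_facet l)"
proof -
  have "ref_facet l = ref_simplex \<inter> {\<xi>. facet_normal l \<bullet> \<xi> = facet_offset l}"
    by (auto simp: ref_facet_def)
  then show ?thesis
    by (simp add: compact_Int_closed compact_ref_simplex closed_hyperplane)
qed

lemma ref_facet_measurable [measurable]: "ref_facet l \<in> sets borel"
  by (rule borel_closed[OF compact_imp_closed[OF compact_ref_facet]])

lemma facet_normal_norm: "(facet_normal l :: real ^ 'd) \<bullet> facet_normal l = 1"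
  by (cases l) (simp_all add: inner_vec_def axis_def if_distrib[of "\<lambda>x. x * _"] cong: if_cong)

lemma integrable_ref_simplex:
  fixes f :: "real ^ 'd \<Rightarrow> real"
  assumes "continuous_on UNIV f"
  shows "integrable lborel (\<lambda>x. indicator ref_simplex x * f x)"
  using borel_integrable_compact[OF compact_ref_simplex continuous_on_subset[OF assms subset_UNIV]]
  by simp

text \<open>On the slab \<open>a \<bullet> x\<close> is bounded, and so is
  \<open>a \<bullet> (x + r x *\<^sub>R e)\<close> when that point lies in \<open>K\<close>. The
  difference of the two bounds \<open>r x\<close>, so \<open>x\<close> stays at bounded distance
  from \<open>K\<close>.\<close>

lemma compact_projection_vimage:
  fixes n e :: "'a::euclidean_space"
  assumes K: "compact K" and ae: "a \<bullet> e \<noteq> 0"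
    and P: "continuous_on UNIV r"
  shows "compact (slab a c \<inter> (\<lambda>x. x + r x *\<^sub>R e) -` K)"
proof -
  have "closed (slab a c \<inter> (\<lambda>x. x + r x *\<^sub>R e) -` K)"
    by (intro closed_Int closed_slab closed_vimage compact_imp_closed[OF K] continuous_intros P)
  moreover have "bounded (slab a c \<inter> (\<lambda>x. x + r x *\<^sub>R e) -` K)"
  proof -
    obtain B where B: "\<And>y. y \<in> K \<Longrightarrow> norm y \<le> B"
      using compact_imp_bounded[OF K] by (auto simp: bounded_iff)
    have "norm x \<le> B + (norm a * B + \<bar>c\<bar> + 1) / \<bar>a \<bullet> e\<bar> * norm e"
      if x: "x \<in> slab a c" "x + r x *\<^sub>R e \<in> K" for x
    proof -
      have 1: "norm (x + r x *\<^sub>R e) \<le> B"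
        using B x by blast
      have "\<bar>r x\<bar> * \<bar>a \<bullet> e\<bar> = \<bar>a \<bullet> (x + r x *\<^sub>R e) - a \<bullet> x\<bar>"
        by (simp add: inner_add_right abs_mult)
      also have "\<dots> \<le> \<bar>a \<bullet> (x + r x *\<^sub>R e)\<bar> + \<bar>a \<bullet> x\<bar>"
        by simp
      also have "\<bar>a \<bullet> (x + r x *\<^sub>R e)\<bar> \<le> norm a * norm (x + r x *\<^sub>R e)"
        by (rule Cauchy_Schwarz_ineq2)
      also have "\<dots> \<le> norm a * B"
        using 1 by (intro mult_left_mono) auto
      also have "\<bar>a \<bullet> x\<bar> \<le> \<bar>c\<bar> + 1"
        using x by (auto simp: slab_def)
      finally have "\<bar>r x\<bar> \<le> (norm a * B + \<bar>c\<bar> + 1) / \<bar>a \<bullet> e\<bar>"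
        using ae by (simp add: field_simps)
      then have "\<bar>r x\<bar> * norm e \<le> (norm a * B + \<bar>c\<bar> + 1) / \<bar>a \<bullet> e\<bar> * norm e"
        by (rule mult_right_mono) simp
      moreover have "norm x \<le> norm (x + r x *\<^sub>R e) + norm (r x *\<^sub>R e)"
        using norm_triangle_ineq4[of "x + r x *\<^sub>R e" "r x *\<^sub>R e"] by simp
      ultimately show ?thesis
        using 1 by simp
    qed
    then show ?thesis
      unfolding bounded_iff by blast
  qed
  ultimately show ?thesis
    by (simp add: compact_eq_bounded_closed)
qed

text \<open>Leaving \<open>r\<close> general covers both the orthogonal projection in
  \<open>hyperplane_measure\<close> and the projections along a coordinate axis onto the two facets
  at the ends of a chord.\<close>

lemma integrable_projection:
  fixes e :: "'a::euclidean_space" and f :: "'a \<Rightarrow> real"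
  assumes K: "compact K" and ae: "a \<bullet> e \<noteq> 0" and r: "continuous_on UNIV r"
    and f: "continuous_on UNIV f"
  shows "integrable lborel (\<lambda>x. indicator (slab a c) x *
    (indicator K (x + r x *\<^sub>R e) * f (x + r x *\<^sub>R e)))"
proof -
  have "continuous_on UNIV (\<lambda>x. f (x + r x *\<^sub>R e))"
    using f by (rule continuous_on_compose2) (auto intro!: continuous_intros r)
  then have "integrable lborel (\<lambda>x. indicator (slab a c \<inter> (\<lambda>x. x + r x *\<^sub>R e) -` K) x *\<^sub>R f (x + r x *\<^sub>R e))"
    by (intro borel_integrable_compact compact_projection_vimage K ae r) (rule continuous_on_subset, auto)
  then show ?thesis
    by (rule back_subst[where P = "integrable lborel"]) (auto simp: indicator_def fun_eq_iff)
qed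

lemma integrable_hyperplane_measure:
  fixes f :: "real ^ 'd \<Rightarrow> real"
  assumes K: "compact K" and f: "continuous_on UNIV f" and n: "n \<bullet> n = 1"
  shows "integrable (hyperplane_measure n b) (\<lambda>x. indicator K x * f x)"
proof -
  have [measurable]: "K \<in> sets borel" "f \<in> borel_measurable borel"
    using K f by (auto intro: borel_closed compact_imp_closed borel_measurable_continuous_onI)
  have "integrable lborel (\<lambda>x. indicator (slab n b) x *
      (indicator K (x + (b - n \<bullet> x) *\<^sub>R n) * f (x + (b - n \<bullet> x) *\<^sub>R n)))"
    using n by (intro integrable_projection K f continuous_intros) auto
  then show ?thesis
    unfolding hyperplane_measure_eq
    by (subst integrable_distr_restrict_space) (auto simp: algebra_simps)
qed

text \<open>A line parallel to the axis enters the simplex through the facet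
  \<open>Some \<nu>\<close> and leaves it through \<open>None\<close>; the fundamental theorem of
  calculus applies on this chord. The indicators take care of lines that miss the simplex.\<close>

lemma integral_line_ref_simplex:
  fixes \<phi> :: "real ^ 'd \<Rightarrow> real" and \<nu> :: 'd
  defines "e \<equiv> axis \<nu> 1"
  assumes \<phi>: "\<And>x. (\<phi> has_derivative \<phi>' x) (at x)"
    and cont: "continuous_on UNIV (\<lambda>x. \<phi>' x e)"
  shows "(LINT s|lborel. indicator ref_simplex (x + s *\<^sub>R e) * \<phi>' (x + s *\<^sub>R e) e)
    = indicator (ref_facet None) (x + (1 - (\<Sum>\<mu>\<in>UNIV. x $ \<mu>)) *\<^sub>R e) * \<phi> (x + (1 - (\<Sum>\<mu>\<in>UNIV. x $ \<mu>)) *\<^sub>R e)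
      - indicator (ref_facet (Some \<nu>)) (x + (- x $ \<nu>) *\<^sub>R e) * \<phi> (x + (- x $ \<nu>) *\<^sub>R e)"
proof -
  \<comment> \<open>At the parameter \<open>t1\<close> the coordinate sum reaches 1, at
    \<open>t0\<close> the coordinate \<open>\<nu>\<close> is 0: here the line hits the two
    hyperplanes.\<close>
  define t1 where "t1 = 1 - (\<Sum>\<mu>\<in>UNIV. x $ \<mu>)"
  define t0 where "t0 = - x $ \<nu>"
  have comp: "(x + s *\<^sub>R e) $ \<mu> = (if \<mu> = \<nu> then x $ \<nu> + s else x $ \<mu>)" for s \<mu>
    by (simp add: e_def axis_def)
  have sum: "(\<Sum>\<mu>\<in>UNIV. (x + s *\<^sub>R e) $ \<mu>) = (\<Sum>\<mu>\<in>UNIV. x $ \<mu>) + s" for s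
    unfolding vector_add_component sum.distrib
    by (simp add: e_def axis_def if_distrib cong: if_cong)
  have mem: "x + s *\<^sub>R e \<in> ref_simplex \<longleftrightarrow> (\<forall>\<mu>. \<mu> \<noteq> \<nu> \<longrightarrow> 0 \<le> x $ \<mu>) \<and> t0 \<le> s \<and> s \<le> t1" for s
    unfolding ref_simplex_def mem_Collect_eq sum unfolding comp t0_def t1_def by auto
  have "facet_normal None \<bullet> y = (\<Sum>\<mu>\<in>UNIV. y $ \<mu>) / sqrt (real CARD('d))" for y :: "real ^ 'd"
    by (simp add: inner_vec_def sum_divide_distrib)
  \<comment> \<open>At \<open>t1\<close> and \<open>t0\<close> the line is on the hyperplane of the
    facet anyway, so membership in the facet amounts to membership in the simplex.\<close>
  then have F1: "x + t1 *\<^sub>R e \<in> ref_facet None \<longleftrightarrow> x + t1 *\<^sub>R e \<in> ref_simplex"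
    by (simp only: ref_facet_def mem_Collect_eq sum) (simp add: t1_def)
  have F0: "x + t0 *\<^sub>R e \<in> ref_facet (Some \<nu>) \<longleftrightarrow> x + t0 *\<^sub>R e \<in> ref_simplex"
    by (auto simp: ref_facet_def inner_axis' t0_def e_def)
  show ?thesis
    unfolding t0_def[symmetric] t1_def[symmetric]
  proof (cases "(\<forall>\<mu>. \<mu> \<noteq> \<nu> \<longrightarrow> 0 \<le> x $ \<mu>) \<and> t0 \<le> t1")
    case True
    then have "(LINT s|lborel. indicator ref_simplex (x + s *\<^sub>R e) * \<phi>' (x + s *\<^sub>R e) e)
        = (LINT s|lborel. indicator {t0..t1} s *\<^sub>R \<phi>' (x + s *\<^sub>R e) e)"
      by (intro Bochner_Integration.integral_cong) (auto simp: indicator_def mem)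
    also have "\<dots> = \<phi> (x + t1 *\<^sub>R e) - \<phi> (x + t0 *\<^sub>R e)"
    proof (rule integral_FTC_atLeastAtMost)
      show "t0 \<le> t1" using True by simp
      show "continuous_on {t0..t1} (\<lambda>s. \<phi>' (x + s *\<^sub>R e) e)"
        by (rule continuous_on_compose2[OF cont]) (auto intro!: continuous_intros)
      fix s
      have "((\<lambda>s. \<phi> (x + s *\<^sub>R e)) has_derivative (\<lambda>h. \<phi>' (x + s *\<^sub>R e) (h *\<^sub>R e))) (at s within {t0..t1})"
        by (rule has_derivative_compose[OF _ \<phi>]) (auto intro!: derivative_eq_intros)
      moreover have "linear (\<phi>' (x + s *\<^sub>R e))"
        using \<phi> has_derivative_linear by blast
      ultimately show "((\<lambda>s. \<phi> (x + s *\<^sub>R e)) has_vector_derivative \<phi>' (x + s *\<^sub>R e) e) (at s within {t0..t1})"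
        by (simp add: has_vector_derivative_def linear_cmul)
    qed
    finally show "(LINT s|lborel. indicator ref_simplex (x + s *\<^sub>R e) * \<phi>' (x + s *\<^sub>R e) e)
      = indicator (ref_facet None) (x + t1 *\<^sub>R e) * \<phi> (x + t1 *\<^sub>R e)
        - indicator (ref_facet (Some \<nu>)) (x + t0 *\<^sub>R e) * \<phi> (x + t0 *\<^sub>R e)"
      using True by (simp add: indicator_def F0 F1 mem)
  next
    case False
    then have "x + s *\<^sub>R e \<notin> ref_simplex" for s
      unfolding mem by auto
    then show "(LINT s|lborel. indicator ref_simplex (x + s *\<^sub>R e) * \<phi>' (x + s *\<^sub>R e) e)
      = indicator (ref_facet None) (x + t1 *\<^sub>R e) * \<phi> (x + t1 *\<^sub>R e)
        - indicator (ref_facet (Some \<nu>)) (x + t0 *\<^sub>R e) * \<phi> (x + t0 *\<^sub>R e)"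
      by (simp add: indicator_def F0 F1)
  qed
qed

text \<open>Averages the chord formula over a slab transversal to the axis. Both chord ends are
  projections along \<open>e\<close>: orthogonal for the facet \<open>Some \<nu>\<close>, oblique
  for \<open>None\<close>, where the density \<open>n \<bullet> e\<close> is
  \<open>1 / sqrt (real CARD('d))\<close>.\<close>

lemma integral_partial_derivative_ref_simplex:
  fixes \<phi> :: "real ^ 'd \<Rightarrow> real" and \<nu> :: 'd
  assumes \<phi>: "\<And>x. (\<phi> has_derivative \<phi>' x) (at x)"
    and cont: "continuous_on UNIV (\<lambda>x. \<phi>' x (axis \<nu> 1))"
  shows "(LINT x:ref_simplex|lborel. \<phi>' x (axis \<nu> 1)) =
    (LINT x:ref_facet None|hyperplane_measure (facet_normal None) (facet_offset (None :: 'd option)). \<phi> x)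
      / sqrt (real CARD('d))
    - (LINT x:ref_facet (Some \<nu>)|hyperplane_measure (facet_normal (Some \<nu>)) (facet_offset (Some \<nu>)). \<phi> x)"
proof -
  define e :: "real ^ 'd" where "e = axis \<nu> 1"
  define n :: "real ^ 'd" where "n = facet_normal None"
  define b where "b = facet_offset (None :: 'd option)"
  have cont_\<phi>: "continuous_on UNIV \<phi>"
    using \<phi> by (meson continuous_at_imp_continuous_on has_derivative_continuous)
  then have [measurable]: "\<phi> \<in> borel_measurable borel"
    by (rule borel_measurable_continuous_onI)
  have ee: "e \<bullet> e = 1"
    by (simp add: e_def inner_axis)
  have nn: "n \<bullet> n = 1"
    unfolding n_def by (rule facet_normal_norm)
  have ne: "n \<bullet> e = 1 / sqrt (real CARD('d))"
    by (simp add: n_def e_def inner_axis)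
  \<comment> \<open>The unit vector \<open>e\<close> is itself a point of the slanted facet.\<close>
  have b: "b = n \<bullet> e"
    unfolding ne by (simp add: b_def)
  have proj: "x - ((n \<bullet> x - b) / (n \<bullet> e)) *\<^sub>R e = x + (1 - (\<Sum>\<mu>\<in>UNIV. x $ \<mu>)) *\<^sub>R e" for x
  proof -
    have "n \<bullet> x = (\<Sum>\<mu>\<in>UNIV. x $ \<mu>) * (n \<bullet> e)"
      unfolding ne by (simp add: n_def inner_vec_def sum_divide_distrib)
    then show ?thesis
      by (simp add: b ne diff_divide_distrib algebra_simps)
  qed
  \<comment> \<open>The averaging uses the very slab that underlies the measure on the facet
    \<open>Some \<nu>\<close>, whose normal is \<open>- e\<close>; the term for this facet then
    needs no change of slab.\<close>
  have slab: "slab (facet_normal (Some \<nu>)) (facet_offset (Some \<nu>)) = slab e (-1)"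
    by (auto simp: slab_def e_def)
  let ?F1 = "\<lambda>x. indicator (ref_facet None) (x + (1 - (\<Sum>\<mu>\<in>UNIV. x $ \<mu>)) *\<^sub>R e)
    * \<phi> (x + (1 - (\<Sum>\<mu>\<in>UNIV. x $ \<mu>)) *\<^sub>R e)"
  let ?F0 = "\<lambda>x. indicator (ref_facet (Some \<nu>)) (x + (- x $ \<nu>) *\<^sub>R e) * \<phi> (x + (- x $ \<nu>) *\<^sub>R e)"
  have "(LINT x:ref_simplex|lborel. \<phi>' x e) = (LINT x|lborel. indicator ref_simplex x * \<phi>' x e)"
    by (simp add: set_lebesgue_integral_def)
  also have "\<dots> = (LINT x|lborel. indicator (slab e (-1)) x
      * (LINT s|lborel. indicator ref_simplex (x + s *\<^sub>R e) * \<phi>' (x + s *\<^sub>R e) e))"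
    using cont unfolding e_def[symmetric]
    by (intro integral_line_average[OF ee] integrable_ref_simplex)
  also have "\<dots> = (LINT x|lborel. indicator (slab e (-1)) x * (?F1 x - ?F0 x))"
    unfolding e_def by (subst integral_line_ref_simplex[OF \<phi> cont]) (rule refl)
  also have "\<dots> = (LINT x|lborel. indicator (slab e (-1)) x * ?F1 x) - (LINT x|lborel. indicator (slab e (-1)) x * ?F0 x)"
    unfolding right_diff_distrib
    by (intro Bochner_Integration.integral_diff integrable_projection compact_ref_facet cont_\<phi> continuous_intros)
      (auto simp: ee)
  also have "(LINT x|lborel. indicator (slab e (-1)) x * ?F0 x)
      = (LINT x:ref_facet (Some \<nu>)|hyperplane_measure (facet_normal (Some \<nu>)) (facet_offset (Some \<nu>)). \<phi> x)"
    unfolding set_lebesgue_integral_def hyperplane_measure_eq slab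
    by (subst integral_distr_restrict_space) (auto simp: e_def inner_axis' intro!: Bochner_Integration.integral_cong)
  also have "(LINT x|lborel. indicator (slab e (-1)) x * ?F1 x)
      = (LINT x|distr (restrict_space lborel (slab e (-1))) borel (\<lambda>x. x - ((n \<bullet> x - b) / (n \<bullet> e)) *\<^sub>R e).
          indicator (ref_facet None) x * \<phi> x)"
    by (subst integral_distr_restrict_space) (auto simp: proj)
  also have "\<dots> = (LINT x|density (hyperplane_measure n b) (\<lambda>_. n \<bullet> e). indicator (ref_facet None) x * \<phi> x)"
    using nn by (subst distr_oblique_projection) (auto simp: ee ne)
  also have "\<dots> = (LINT x:ref_facet None|hyperplane_measure n b. \<phi> x) / sqrt (real CARD('d))"
    by (subst integral_density) (auto simp: ne set_lebesgue_integral_def)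
  finally show ?thesis
    unfolding e_def n_def b_def .
qed

section \<open>Polynomials and integration by parts\<close>

lemma continuous_on_real_polynomial_function:
  "real_polynomial_function p \<Longrightarrow> continuous_on S p"
  by (simp add: continuous_on_polymonial_function real_polynomial_function_eq)

text \<open>Structural induction with the sum and product rules. That the partial derivatives are
  polynomial is recorded because it provides the continuity required by the divergence
  theorem.\<close>

lemma real_polynomial_function_has_derivative:
  assumes "real_polynomial_function p"
  obtains p' where "\<And>x. (p has_derivative p' x) (at x)" "\<And>h. real_polynomial_function (\<lambda>x. p' x h)"
proof -
  have "\<exists>p'. (\<forall>x. (p has_derivative p' x) (at x)) \<and> (\<forall>h. real_polynomial_function (\<lambda>x. p' x h))"
    using assms
  proof induction
    case (linear f)
    then show ?case
      by (intro exI[of _ "\<lambda>_. f"]) (auto intro: bounded_linear_imp_has_derivative)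
  next
    case (const c)
    show ?case
      by (intro exI[of _ "\<lambda>_ _. 0"]) auto
  next
    case (add f g)
    then obtain f' g' where "\<And>x. (f has_derivative f' x) (at x)" "\<And>h. real_polynomial_function (\<lambda>x. f' x h)"
      "\<And>x. (g has_derivative g' x) (at x)" "\<And>h. real_polynomial_function (\<lambda>x. g' x h)"
      by metis
    then show ?case
      by (intro exI[of _ "\<lambda>x h. f' x h + g' x h"]) (auto intro: has_derivative_add real_polynomial_function.intros(3))
  next
    case (mult f g)
    then obtain f' g' where "\<And>x. (f has_derivative f' x) (at x)" "\<And>h. real_polynomial_function (\<lambda>x. f' x h)"
      "\<And>x. (g has_derivative g' x) (at x)" "\<And>h. real_polynomial_function (\<lambda>x. g' x h)"
      by metis
    with mult.hyps show ?case
      by (intro exI[of _ "\<lambda>x h. f x * g' x h + f' x h * g x"] conjI allI has_derivative_mult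
          real_polynomial_function.intros(3,4))
  qed
  then show ?thesis
    using that by blast
qed

text \<open>On the line from \<open>a\<close> to \<open>x\<close> the difference to \<open>c\<close>
  is a polynomial in one variable that vanishes near parameter 0, hence at infinitely many
  parameters, hence also at parameter 1, which is \<open>x\<close>.\<close>

lemma real_polynomial_function_eq_const:
  fixes p :: "'a::real_normed_vector \<Rightarrow> real"
  assumes p: "real_polynomial_function p" and U: "open U" "a \<in> U" and c: "\<And>x. x \<in> U \<Longrightarrow> p x = c"
  shows "p x = c"
proof -
  define q where "q t = p (a + t *\<^sub>R (x - a)) - c" for t :: real
  have "polynomial_function (\<lambda>t :: real. a + t *\<^sub>R (x - a))"
    by (intro polynomial_function_add polynomial_function_const polynomial_function_bounded_linear
        bounded_linear_scaleR_left)
  then have "real_polynomial_function q"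
    unfolding q_def using real_polynomial_function_compose[OF _ p]
    by (intro real_polynomial_function_diff real_polynomial_function.intros(2)) (simp add: o_def)
  then obtain k n where k: "q = (\<lambda>t. \<Sum>i\<le>n. k i * t ^ i)"
    using real_polynomial_function_imp_sum by blast
  have "open ((\<lambda>t :: real. a + t *\<^sub>R (x - a)) -` U)"
    by (intro open_vimage U continuous_intros)
  moreover have "0 \<in> (\<lambda>t :: real. a + t *\<^sub>R (x - a)) -` U"
    using U by simp
  ultimately have "infinite ((\<lambda>t :: real. a + t *\<^sub>R (x - a)) -` U)"
    using finite_imp_not_open by blast
  moreover have "(\<lambda>t :: real. a + t *\<^sub>R (x - a)) -` U \<subseteq> {t. (\<Sum>i\<le>n. k i * t ^ i) = 0}"
    using c by (auto simp: q_def simp flip: fun_cong[OF k])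
  ultimately have "infinite {t. (\<Sum>i\<le>n. k i * t ^ i) = 0}"
    using infinite_super by blast
  then have "\<forall>i\<le>n. k i = 0"
    using polyfun_finite_roots[of k n] by blast
  then have "q 1 = 0"
    by (simp add: k)
  then show ?thesis
    by (simp add: q_def)
qed

section \<open>Polynomial spaces and the inner product on the reference simplex\<close>

lemma finite_multi_indices: "finite {m :: 'd::finite \<Rightarrow> nat. (\<Sum>\<nu>\<in>UNIV. m \<nu>) \<le> k}"
proof (rule finite_subset)
  show "{m. (\<Sum>\<nu>\<in>UNIV. m \<nu>) \<le> k} \<subseteq> (\<Pi>\<^sub>E (\<nu>::'d)\<in>UNIV. {..k})"
  proof (intro subsetI PiE_I)
    fix m :: "'d \<Rightarrow> nat" and \<nu> assume "m \<in> {m. (\<Sum>\<nu>\<in>UNIV. m \<nu>) \<le> k}"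
    then show "m \<nu> \<in> {..k}"
      using member_le_sum[of \<nu> UNIV m] by simp
  qed simp
qed (simp add: finite_PiE)

lemma poly_space_imp_real_polynomial_function:
  "p \<in> poly_space k \<Longrightarrow> real_polynomial_function p"
  unfolding poly_space_def
  by (auto intro!: real_polynomial_function_sum real_polynomial_function_prod finite_multi_indices
      real_polynomial_function.intros(4) real_polynomial_function_power)

lemma poly_space_diff_const:
  fixes p :: "real ^ 'd \<Rightarrow> real"
  assumes "p \<in> poly_space k"
  shows "(\<lambda>\<xi>. p \<xi> - c) \<in> poly_space k"
proof -
  define X :: "('d \<Rightarrow> nat) \<Rightarrow> real ^ 'd \<Rightarrow> real" where "X m \<xi> = (\<Prod>\<nu>\<in>UNIV. (\<xi> $ \<nu>) ^ m \<nu>)" for m \<xi>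
  define I :: "('d \<Rightarrow> nat) set" where "I = {m. (\<Sum>\<nu>\<in>UNIV. m \<nu>) \<le> k}"
  obtain a where a: "p = (\<lambda>\<xi>. \<Sum>m\<in>I. a m * X m \<xi>)"
    using assms unfolding poly_space_def I_def X_def by blast
  have "(\<Sum>m\<in>I. (if m = (\<lambda>_. 0) then c else 0) * X m \<xi>) = c" for \<xi>
    using finite_multi_indices[where 'd = 'd and k = k]
    by (simp add: if_distrib[of "\<lambda>x. x * _"] I_def X_def cong: if_cong)
  then have "(\<lambda>\<xi>. p \<xi> - c) = (\<lambda>\<xi>. \<Sum>m\<in>I. (a m - (if m = (\<lambda>_. 0) then c else 0)) * X m \<xi>)"
    unfolding a left_diff_distrib sum_subtractf by simp
  then show ?thesis
    unfolding poly_space_def I_def X_def by (intro CollectI exI)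
qed

lemma interior_ref_simplex_nonempty: "interior (ref_simplex :: (real ^ 'd) set) \<noteq> {}"
proof -
  define W :: "(real ^ 'd) set" where "W = (\<Inter>\<nu>. {\<xi>. 0 < \<xi> $ \<nu>}) \<inter> {\<xi>. (\<Sum>\<nu>\<in>UNIV. \<xi> $ \<nu>) < 1}"
  have "open W"
    unfolding W_def by (intro open_Int open_INT finite ballI open_Collect_less continuous_intros)
  moreover have "W \<subseteq> ref_simplex"
    by (auto simp: W_def ref_simplex_def intro: less_imp_le)
  \<comment> \<open>All coordinates are positive and their sum is 1/2.\<close>
  moreover have "(\<chi> \<nu>. 1 / (2 * real CARD('d))) \<in> W"
    by (simp add: W_def)
  ultimately show ?thesis
    using interior_maximal by blast
qed

text \<open>Carries constancy from the open simplex, where \<open>is_pull_back\<close> prescribes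
  the values cell by cell, to the facets on which traces are taken.\<close>

lemma eq_const_if_interior_ref_simplex:
  fixes p :: "real ^ 'd \<Rightarrow> real"
  assumes "real_polynomial_function p" "\<And>\<xi>. \<xi> \<in> interior ref_simplex \<Longrightarrow> p \<xi> = c"
  shows "p = (\<lambda>_. c)"
proof -
  obtain a where "a \<in> interior (ref_simplex :: (real ^ 'd) set)"
    using interior_ref_simplex_nonempty by blast
  then show ?thesis
    using real_polynomial_function_eq_const[OF assms(1) open_interior _ assms(2)] by blast
qed

text \<open>The square of \<open>p\<close> vanishes almost everywhere on the simplex, so the part of
  the interior where \<open>p\<close> differs from 0 is an open null set and therefore
  empty.\<close>

lemma ref_inner_self_eq_0:
  fixes p :: "real ^ 'd \<Rightarrow> real"
  assumes p: "real_polynomial_function p" and "ref_inner p p = 0"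
  shows "p = (\<lambda>_. 0)"
proof -
  have cont: "continuous_on S p" for S
    using p by (rule continuous_on_real_polynomial_function)
  have "AE x in lborel. indicator ref_simplex x * (p x * p x) = 0"
    using assms(2) cont
    by (subst integral_nonneg_eq_0_iff_AE[symmetric])
      (auto simp: ref_inner_def set_lebesgue_integral_def intro!: integrable_ref_simplex continuous_intros)
  define W where "W = {x \<in> interior ref_simplex. p x \<noteq> 0}"
  have "W = interior ref_simplex \<inter> p -` (- {0})"
    by (auto simp: W_def)
  then have "open W"
    using cont by (simp add: continuous_open_preimage open_Compl)
  have "AE x in lborel. x \<notin> W"
    using \<open>AE x in lborel. indicator ref_simplex x * (p x * p x) = 0\<close>
    by (rule AE_mp) (use interior_subset in \<open>auto simp: W_def indicator_def\<close>)
  then have "W \<in> null_sets lborel"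
    using \<open>open W\<close> by (subst AE_iff_null_sets) auto
  then have "negligible W"
    by (simp add: negligible_iff_null_sets null_sets_completionI)
  then have "W = {}"
    using \<open>open W\<close> open_not_negligible by blast
  then show ?thesis
    by (intro eq_const_if_interior_ref_simplex p) (auto simp: W_def)
qed

text \<open>Testing with \<open>v = p - c\<close>, which lies in the same space, turns the
  hypothesis into \<open>a * ref_inner v v = 0\<close>. In the scheme \<open>a\<close> is a stage
  metric term.\<close>

lemma ref_inner_eq_imp_const:
  fixes p :: "real ^ 'd \<Rightarrow> real"
  assumes p: "p \<in> poly_space k" and a: "a \<noteq> 0"
    and eq: "\<And>v. v \<in> poly_space k \<Longrightarrow> ref_inner (\<lambda>\<xi>. a * p \<xi>) v = ref_inner (\<lambda>\<xi>. a * c) v"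
  shows "p = (\<lambda>_. c)"
proof -
  define v where "v \<xi> = p \<xi> - c" for \<xi>
  have v: "v \<in> poly_space k"
    unfolding v_def by (rule poly_space_diff_const[OF p])
  have poly: "real_polynomial_function p" "real_polynomial_function v"
    using p v by (auto intro: poly_space_imp_real_polynomial_function)
  have "a * ref_inner v v = (LINT x|lborel. a * (indicator ref_simplex x * (v x * v x)))"
    by (simp add: ref_inner_def set_lebesgue_integral_def)
  also have "\<dots> = (LINT x|lborel. indicator ref_simplex x * (a * p x * v x) - indicator ref_simplex x * (a * c * v x))"
    by (intro Bochner_Integration.integral_cong refl) (simp add: v_def algebra_simps)
  also have "\<dots> = ref_inner (\<lambda>\<xi>. a * p \<xi>) v - ref_inner (\<lambda>\<xi>. a * c) v"
    unfolding ref_inner_def set_lebesgue_integral_def real_scaleR_def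
    by (intro Bochner_Integration.integral_diff integrable_ref_simplex continuous_intros
        continuous_on_real_polynomial_function poly)
  finally have "a * ref_inner v v = ref_inner (\<lambda>\<xi>. a * p \<xi>) v - ref_inner (\<lambda>\<xi>. a * c) v" .
  then have "ref_inner v v = 0"
    using eq[OF v] a by simp
  from ref_inner_self_eq_0[OF poly(2) this] show ?thesis
    by (simp add: v_def fun_eq_iff)
qed

section \<open>Gradient, divergence and integration by parts\<close>

lemma grad_eq:
  assumes "(v has_derivative v') (at \<xi>)"
  shows "grad v \<xi> $ \<nu> = v' (axis \<nu> 1)"
  using frechet_derivative_at[OF assms] by (simp add: grad_def)

lemma divergence_affine: "divergence (\<lambda>\<xi>. M *v \<xi> + g) x = trace M"
proof -
  have "((\<lambda>\<xi>. M *v \<xi> + g) has_derivative (*v) M) (at x)"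
    by (auto intro!: derivative_eq_intros bounded_linear_imp_has_derivative matrix_vector_mul_bounded_linear)
  from frechet_derivative_at[OF this, symmetric] show ?thesis
    by (simp add: divergence_def trace_def matrix_vector_mult_basis column_def)
qed

text \<open>The coordinate formula is applied to each component \<open>F \<nu>\<close> of the affine
  field times \<open>v\<close> and summed over \<open>\<nu>\<close>. The factors
  \<open>1 / sqrt (real CARD('d))\<close> and -1 in it are components of the facet normals. The left
  side has the shape of \<open>ale_form\<close> for an affine flux.\<close>

lemma integration_by_parts_ref_simplex:
  fixes v :: "real ^ 'd \<Rightarrow> real" and M :: "real ^ 'd ^ 'd"
  assumes v: "real_polynomial_function v"
  shows "(LINT \<xi>:ref_simplex|lborel. (M *v \<xi> + g) \<bullet> grad v \<xi>)
      - ref_boundary_integral (\<lambda>l \<xi>. ((M *v \<xi> + g) \<bullet> facet_normal l) * v \<xi>)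
    = - trace M * (LINT \<xi>:ref_simplex|lborel. v \<xi>)"
proof -
  obtain v' where v': "\<And>x. (v has_derivative v' x) (at x)" "\<And>h. real_polynomial_function (\<lambda>x. v' x h)"
    using real_polynomial_function_has_derivative[OF v] by blast
  define F where "F \<nu> x = (M *v x + g) $ \<nu>" for \<nu> x
  have [continuous_intros]: "continuous_on S v" "continuous_on S (\<lambda>x. v' x h)" for S h
    using v v' by (auto intro: continuous_on_real_polynomial_function)
  have [continuous_intros]: "continuous_on S (F \<nu>)" for S \<nu>
    unfolding F_def by (intro continuous_intros)
  let ?\<mu> = "\<lambda>l :: 'd option. hyperplane_measure (facet_normal l) (facet_offset l)"
  have int: "integrable (?\<mu> l) (\<lambda>x. indicator (ref_facet l) x * (F \<nu> x * v x))" for l \<nu>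
    by (intro integrable_hyperplane_measure compact_ref_facet facet_normal_norm continuous_intros)
  have "(LINT x:ref_simplex|lborel. M $ \<nu> $ \<nu> * v x + F \<nu> x * v' x (axis \<nu> 1))
      = (LINT x:ref_facet None|?\<mu> None. F \<nu> x * v x) / sqrt (real CARD('d))
        - (LINT x:ref_facet (Some \<nu>)|?\<mu> (Some \<nu>). F \<nu> x * v x)" (is "?L \<nu> = ?R \<nu>") for \<nu>
  proof -
    let ?\<phi>' = "\<lambda>x h. F \<nu> x * v' x h + (M *v h) $ \<nu> * v x"
    have "(F \<nu> has_derivative (\<lambda>h. (M *v h) $ \<nu>)) (at x)" for x
      unfolding F_def
      by (auto intro!: derivative_eq_intros bounded_linear_imp_has_derivative
          bounded_linear_compose[OF bounded_linear_vec_nth matrix_vector_mul_bounded_linear])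
    then have "((\<lambda>x. F \<nu> x * v x) has_derivative ?\<phi>' x) (at x)" for x
      using v' by (intro has_derivative_mult)
    moreover have "continuous_on UNIV (\<lambda>x. ?\<phi>' x (axis \<nu> 1))"
      by (intro continuous_intros)
    ultimately show ?thesis
      using integral_partial_derivative_ref_simplex[of "\<lambda>x. F \<nu> x * v x" ?\<phi>' \<nu>]
      by (simp add: matrix_vector_mult_basis column_def add.commute)
  qed
  then have "(\<Sum>\<nu>\<in>UNIV. ?L \<nu>) = (\<Sum>\<nu>\<in>UNIV. ?R \<nu>)"
    by simp
  moreover have "(\<Sum>\<nu>\<in>UNIV. ?L \<nu>) = trace M * (LINT x:ref_simplex|lborel. v x)
      + (LINT x:ref_simplex|lborel. (M *v x + g) \<bullet> grad v x)"
  proof -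
    have "(\<Sum>\<nu>\<in>UNIV. ?L \<nu>) = (LINT x|lborel. (\<Sum>\<nu>\<in>UNIV. indicator ref_simplex x * (M $ \<nu> $ \<nu> * v x + F \<nu> x * v' x (axis \<nu> 1))))"
      unfolding set_lebesgue_integral_def real_scaleR_def
      by (intro Bochner_Integration.integral_sum[symmetric] integrable_ref_simplex continuous_intros)
    also have "\<dots> = (LINT x|lborel. trace M * (indicator ref_simplex x * v x)
        + indicator ref_simplex x * (\<Sum>\<nu>\<in>UNIV. F \<nu> x * v' x (axis \<nu> 1)))"
      by (intro Bochner_Integration.integral_cong refl)
        (simp add: trace_def sum_distrib_left sum_distrib_right sum.distrib algebra_simps)
    also have "\<dots> = trace M * (LINT x|lborel. indicator ref_simplex x * v x)
        + (LINT x|lborel. indicator ref_simplex x * (\<Sum>\<nu>\<in>UNIV. F \<nu> x * v' x (axis \<nu> 1)))"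
      by (subst Bochner_Integration.integral_add)
        (auto intro!: integrable_ref_simplex continuous_intros)
    also have "(\<lambda>x. \<Sum>\<nu>\<in>UNIV. F \<nu> x * v' x (axis \<nu> 1)) = (\<lambda>x. (M *v x + g) \<bullet> grad v x)"
      by (simp add: inner_vec_def F_def grad_eq[OF v'(1)])
    finally show ?thesis
      by (simp add: set_lebesgue_integral_def)
  qed
  moreover have "(\<Sum>\<nu>\<in>UNIV. ?R \<nu>) = ref_boundary_integral (\<lambda>l \<xi>. ((M *v \<xi> + g) \<bullet> facet_normal l) * v \<xi>)"
  proof -
    have "(LINT x:ref_facet None|?\<mu> None. ((M *v x + g) \<bullet> facet_normal None) * v x)
        = (LINT x|?\<mu> None. (\<Sum>\<nu>\<in>UNIV. indicator (ref_facet None) x * (F \<nu> x * v x) / sqrt (real CARD('d))))"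
      unfolding set_lebesgue_integral_def
      by (intro Bochner_Integration.integral_cong refl)
        (simp add: inner_vec_def F_def sum_distrib_left sum_distrib_right)
    also have "\<dots> = (\<Sum>\<nu>\<in>UNIV. (LINT x:ref_facet None|?\<mu> None. F \<nu> x * v x) / sqrt (real CARD('d)))"
      using int[where l = None] by (simp add: set_lebesgue_integral_def)
    finally have None: "(LINT x:ref_facet None|?\<mu> None. ((M *v x + g) \<bullet> facet_normal None) * v x)
        = (\<Sum>\<nu>\<in>UNIV. (LINT x:ref_facet None|?\<mu> None. F \<nu> x * v x) / sqrt (real CARD('d)))" .
    have Some: "(LINT x:ref_facet (Some \<nu>)|?\<mu> (Some \<nu>). ((M *v x + g) \<bullet> facet_normal (Some \<nu>)) * v x)
        = - (LINT x:ref_facet (Some \<nu>)|?\<mu> (Some \<nu>). F \<nu> x * v x)" for \<nu>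
      unfolding set_lebesgue_integral_def Bochner_Integration.integral_minus[symmetric]
      by (intro Bochner_Integration.integral_cong refl) (simp add: inner_axis F_def algebra_simps)
    \<comment> \<open>Every \<open>\<nu>\<close> contributes to the slanted facet
      \<open>None\<close>, while the facet \<open>Some \<nu>\<close> only sees the component
      \<open>\<nu>\<close>.\<close>
    show ?thesis
      unfolding ref_boundary_integral_def UNIV_option_conv
      by (simp add: sum.reindex None Some sum_subtractf sum_negf del: facet_normal.simps facet_offset.simps)
  qed
  ultimately show ?thesis
    by simp
qed

section \<open>Constant states of the scheme\<close>

lemma cell_map_eq: "cell_map v \<xi> = (\<Sum>\<nu>\<in>UNIV. \<xi> $ \<nu> *\<^sub>R (v (Some \<nu>) - v None)) + v None"
  by (simp add: cell_map_def cell_matrix_def matrix_vector_mult_def vec_eq_iff mult.commute)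

text \<open>Linearity in the vertices: if these move uniformly, so does every mapped point.\<close>

lemma cell_map_add_scaleR: "cell_map (\<lambda>l. v l + r *\<^sub>R w l) \<xi> = cell_map v \<xi> + r *\<^sub>R cell_map w \<xi>"
proof -
  have "\<xi> $ \<nu> *\<^sub>R (v (Some \<nu>) + r *\<^sub>R w (Some \<nu>) - (v None + r *\<^sub>R w None))
      = \<xi> $ \<nu> *\<^sub>R (v (Some \<nu>) - v None) + r *\<^sub>R (\<xi> $ \<nu> *\<^sub>R (w (Some \<nu>) - w None))" for \<nu>
    by (simp add: algebra_simps)
  then show ?thesis
    unfolding cell_map_eq by (simp add: sum.distrib scaleR_sum_right scaleR_add_right)
qed

lemma cell_map_in_convex_hull:
  fixes v :: "'d option \<Rightarrow> real ^ 'd"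
  assumes "\<xi> \<in> ref_simplex"
  shows "cell_map v \<xi> \<in> convex hull range v"
proof -
  \<comment> \<open>The barycentric coordinates of \<open>\<xi>\<close>, with \<open>None\<close>
    for the origin.\<close>
  define w where "w l = (case l of None \<Rightarrow> 1 - (\<Sum>\<nu>\<in>UNIV. \<xi> $ \<nu>) | Some \<nu> \<Rightarrow> \<xi> $ \<nu>)" for l
  have UNIV_sum: "(\<Sum>l\<in>UNIV. f l) = f None + (\<Sum>\<nu>\<in>UNIV. f (Some \<nu>))"
    for f :: "'d option \<Rightarrow> 'a::comm_monoid_add"
    by (simp add: UNIV_option_conv sum.reindex)
  have "(\<Sum>l\<in>UNIV. w l *\<^sub>R v l) \<in> convex hull range v"
  proof (rule convex_sum)
    show "(\<Sum>l\<in>UNIV. w l) = 1"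
      by (simp add: UNIV_sum w_def)
    show "0 \<le> w l" for l
      using assms by (simp add: w_def ref_simplex_def split: option.split)
  qed (auto intro: hull_inc)
  also have "(\<Sum>l\<in>UNIV. w l *\<^sub>R v l) = cell_map v \<xi>"
    by (simp add: UNIV_sum w_def cell_map_eq scaleR_diff_left scaleR_diff_right sum_subtractf scaleR_sum_left)
  finally show ?thesis .
qed

lemma open_cell_map_image:
  assumes "det (cell_matrix v) \<noteq> 0" "open W"
  shows "open (cell_map v ` W)"
proof -
  have "surj ((*v) (cell_matrix v))"
    using assms(1) by (simp add: invertible_det_nz[symmetric] invertible_right_inverse matrix_right_invertible_surjective)
  then have "open ((*v) (cell_matrix v) ` W)"
    using assms(2) by (intro open_surjective_linear_image) auto
  then have "open ((+) (v None) ` (*v) (cell_matrix v) ` W)"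
    by (rule open_translation)
  then show ?thesis
    by (simp add: image_image cell_map_def add.commute)
qed

text \<open>The cells are only known to cover the closure of \<open>\<Omega>\<close>. But the image
  of the open simplex is open, and an open convex set is the interior of its closure.\<close>

lemma cell_map_interior:
  assumes mesh: "regular_mesh \<Omega> cells V" and \<Omega>: "open \<Omega>" "convex \<Omega>"
    and K: "K \<in> cells" and \<xi>: "\<xi> \<in> interior ref_simplex"
  shows "cell_map (V K) \<xi> \<in> \<Omega>"
proof -
  let ?W = "cell_map (V K) ` interior ref_simplex"
  have "det (cell_matrix (V K)) \<noteq> 0"
    using mesh K unfolding regular_mesh_def by (metis less_irrefl)
  then have "open ?W"
    by (rule open_cell_map_image) simp
  moreover have "?W \<subseteq> convex hull range (V K)"
    using interior_subset cell_map_in_convex_hull by blast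
  ultimately have "?W \<subseteq> cell (V K)"
    unfolding cell_def by (rule interior_maximal[rotated])
  also have "\<dots> \<subseteq> closure \<Omega>"
  proof -
    have "closure \<Omega> = (\<Union>K\<in>cells. closure (cell (V K)))"
      using mesh by (simp add: regular_mesh_def)
    then show ?thesis
      using K closure_subset by blast
  qed
  finally have "?W \<subseteq> interior (closure \<Omega>)"
    using \<open>open ?W\<close> by (rule interior_maximal)
  then show ?thesis
    using \<xi> \<Omega> by (auto simp: convex_interior_closure interior_open)
qed

text \<open>Between two time levels the vertices have constant velocities \<open>W\<close>, so the
  grid velocity is the cell map built from \<open>W\<close> in place of the vertices.\<close>

lemma grid_velocity_affine:
  fixes vert :: "nat \<Rightarrow> 'c \<Rightarrow> 'd option \<Rightarrow> real ^ 'd"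
  assumes lt: "tlev n < tlev (Suc n)" and t: "t \<in> {tlev n..tlev (Suc n)}"
  shows "\<exists>B b. \<forall>\<xi>. grid_velocity tlev vert n t K \<xi> = B *v \<xi> + b"
proof -
  define W where "W l = (vert (Suc n) K l - vert n K l) /\<^sub>R (tlev (Suc n) - tlev n)" for l
  have "grid_velocity tlev vert n t K \<xi> = cell_map W \<xi>" for \<xi>
  proof -
    have "cell_map (vert_at tlev vert n \<theta> K) \<xi> = cell_map (vert n K) \<xi> + (\<theta> - tlev n) *\<^sub>R cell_map W \<xi>" for \<theta>
      unfolding cell_map_add_scaleR[symmetric]
      by (rule arg_cong[where f = "\<lambda>v. cell_map v \<xi>"]) (simp add: fun_eq_iff vert_at_def W_def divide_inverse)
    then have "((\<lambda>\<theta>. cell_map (vert_at tlev vert n \<theta> K) \<xi>) has_vector_derivative cell_map W \<xi>)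
        (at t within {tlev n..tlev (Suc n)})"
      by (auto intro!: derivative_eq_intros)
    then show ?thesis
      \<comment> \<open>A nondegenerate interval makes the derivative within it unique, also at its
        end points.\<close>
      unfolding grid_velocity_def using lt t by (intro vector_derivative_within_closed_interval)
  qed
  then show ?thesis
    unfolding cell_map_def by blast
qed

text \<open>Links \<open>suitable_bc\<close>, which speaks of the frontier, to the integrals over
  facets. Each facet lies on the bounding hyperplane of a half-space that contains the
  simplex.\<close>

lemma ref_facet_frontier: "ref_facet (l :: 'd::finite option) \<subseteq> frontier ref_simplex"
proof
  fix \<xi> assume \<xi>: "\<xi> \<in> ref_facet l"
  have "(ref_simplex :: (real ^ 'd) set) \<subseteq> {x. facet_normal l \<bullet> x \<le> facet_offset l}"
  proof (cases l)
    case None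
    have "facet_normal None \<bullet> x = (\<Sum>\<nu>\<in>UNIV. x $ \<nu>) / sqrt (real CARD('d))" for x :: "real ^ 'd"
      by (simp add: inner_vec_def sum_divide_distrib)
    then show ?thesis
      by (auto simp: None ref_simplex_def divide_right_mono)
  qed (auto simp: ref_simplex_def inner_axis')
  then have "interior ref_simplex \<subseteq> interior {x. facet_normal l \<bullet> x \<le> facet_offset l}"
    by (rule interior_mono)
  also have "\<dots> = {x. facet_normal l \<bullet> x < facet_offset l}"
    using facet_normal_norm[of l] by (intro interior_halfspace_le) auto
  finally have "\<xi> \<notin> interior ref_simplex"
    using \<xi> by (auto simp: ref_facet_def)
  moreover have "\<xi> \<in> closure ref_simplex"
    using \<xi> closure_subset by (auto simp: ref_facet_def)
  ultimately show "\<xi> \<in> frontier ref_simplex"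
    by (simp add: frontier_def)
qed

text \<open>As \<open>u L\<close> is constant on the whole space, it does not matter which neighbour
  \<open>SOME\<close> selects or at which point that neighbour is evaluated. Facets without a
  neighbour are left to the boundary condition.\<close>

lemma ext_trace_const:
  assumes bc: "suitable_bc T cells bc" and t: "t \<in> {0..T}" and K: "K \<in> cells"
    and u: "\<And>L. L \<in> cells \<Longrightarrow> u L = (\<lambda>_. c)" and \<xi>: "\<xi> \<in> ref_facet l"
  shows "ext_trace tlev cells vert bc n t u K l \<xi> = c"
proof (cases "\<exists>L. neighbour cells (vert n) K l L")
  case True
  then have "(SOME L. neighbour cells (vert n) K l L) \<in> cells"
    by (metis neighbour_def someI_ex)
  with True u show ?thesis
    by (simp add: ext_trace_def Let_def)
next
  case False
  have "bc t u K \<xi> = c"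
  proof -
    have "\<forall>L\<in>cells. \<forall>\<eta>\<in>ref_simplex. u L \<eta> = c"
      using u by simp
    then have "\<forall>K\<in>cells. \<forall>\<xi>\<in>frontier ref_simplex. bc t u K \<xi> = c"
      using bc t unfolding suitable_bc_def by blast
    then show ?thesis
      using K \<xi> ref_facet_frontier by blast
  qed
  with False show ?thesis
    by (simp add: ext_trace_def)
qed

text \<open>Only the motion of the grid is left: \<open>f c\<close> is a constant vector and drops
  out under the divergence, while the velocity term reproduces the increment in the recursion of
  \<open>stage_metric\<close>.\<close>

lemma ale_form_const:
  fixes vert :: "nat \<Rightarrow> 'c \<Rightarrow> 'd option \<Rightarrow> real ^ 'd"
  assumes flux: "numerical_flux f ghat" and bc: "suitable_bc T cells bc"
    and lt: "tlev n < tlev (Suc n)" and t: "t \<in> {tlev n..tlev (Suc n)}" "t \<in> {0..T}"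
    and K: "K \<in> cells" and u: "\<And>L. L \<in> cells \<Longrightarrow> u L = (\<lambda>_. c)" and v: "v \<in> poly_space k"
  shows "ale_form tlev cells vert f ghat bc n K u v J t
    = c * J * divergence (\<lambda>\<xi>. matrix_inv (cell_matrix (vert_at tlev vert n t K)) *v grid_velocity tlev vert n t K \<xi>) 0
        * (LINT \<xi>:ref_simplex|lborel. v \<xi>)"
proof -
  define A where "A = matrix_inv (cell_matrix (vert_at tlev vert n t K))"
  obtain B b where w: "\<And>\<xi>. grid_velocity tlev vert n t K \<xi> = B *v \<xi> + b"
    using grid_velocity_affine[OF lt t(1), of vert K] by auto
  \<comment> \<open>The velocity enters \<open>ale_flux\<close> with a minus sign, hence
    \<open>- J * c\<close>; it cancels against the minus sign in the integration by parts.\<close>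
  define M where "M = (- J * c) *\<^sub>R (A ** B)"
  define g where "g = J *\<^sub>R (A *v (f c - c *\<^sub>R b))"
  have F: "J *\<^sub>R (A *v ale_flux f (B *v \<xi> + b) c) = M *v \<xi> + g" for \<xi>
  proof -
    have "M *v \<xi> = (- J * c) *\<^sub>R (A *v (B *v \<xi>))"
      unfolding M_def matrix_vector_mul_assoc by (rule scaleR_matrix_vector_assoc[symmetric])
    then show ?thesis
      by (simp add: g_def ale_flux_def matrix_vector_mult_diff_distrib matrix_vector_right_distrib
          matrix_vector_mult_scaleR scaleR_add_right scaleR_diff_right)
  qed
  have div: "divergence (\<lambda>\<xi>. A *v (B *v \<xi> + b)) 0 = trace (A ** B)"
    using divergence_affine[of "A ** B" "A *v b" 0]
    by (simp add: matrix_vector_right_distrib matrix_vector_mul_assoc)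
  have trace: "trace M = - J * c * trace (A ** B)"
    by (simp add: M_def trace_def sum_distrib_left)
  \<comment> \<open>Consistency, which holds for normals of any length, evaluates the numerical
    flux; then the transposed matrix moves from the normal to the flux vector.\<close>
  have "ghat (B *v \<xi> + b) c c (J *\<^sub>R (transpose A *v n)) = (M *v \<xi> + g) \<bullet> n" for \<xi> n
  proof -
    have "ghat (B *v \<xi> + b) c c (J *\<^sub>R (transpose A *v n))
        = ale_flux f (B *v \<xi> + b) c \<bullet> (J *\<^sub>R (transpose A *v n))"
      using flux unfolding numerical_flux_def by blast
    also have "\<dots> = (J *\<^sub>R (A *v ale_flux f (B *v \<xi> + b) c)) \<bullet> n"
      unfolding inner_scaleR_left inner_scaleR_right transpose_matrix_vector
        inner_commute[of "ale_flux f (B *v \<xi> + b) c"] dot_lmul_matrix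
      by (simp only: inner_commute)
    finally show ?thesis
      by (simp add: F)
  qed
  \<comment> \<open>The exterior trace is known to be \<open>c\<close> on the facet only; elsewhere
    the indicator vanishes.\<close>
  then have boundary: "ref_boundary_integral (\<lambda>l \<xi>. ghat (B *v \<xi> + b) c (ext_trace tlev cells vert bc n t u K l \<xi>)
        (J *\<^sub>R (transpose A *v facet_normal l)) * v \<xi>)
      = ref_boundary_integral (\<lambda>l \<xi>. ((M *v \<xi> + g) \<bullet> facet_normal l) * v \<xi>)"
    unfolding ref_boundary_integral_def set_lebesgue_integral_def
    using ext_trace_const[OF bc t(2) K u]
    by (intro sum.cong Bochner_Integration.integral_cong) (auto simp: indicator_def)
  show ?thesis
    using integration_by_parts_ref_simplex[OF poly_space_imp_real_polynomial_function[OF v], of M g]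
    unfolding ale_form_def Let_def u[OF K] A_def[symmetric] w F boundary div
    by (simp add: trace)
qed

lemma ref_inner_const: "ref_inner (\<lambda>_. a) v = a * (LINT \<xi>:ref_simplex|lborel. v \<xi>)"
  by (simp add: ref_inner_def)

section \<open>The discrete geometric conservation law\<close>

theorem corollary4p4:
  fixes \<Omega> :: "(real ^ 'd) set"
    and T \<kappa> \<tau> :: real and N s k :: nat
    and tlev :: "nat \<Rightarrow> real"
    and cells :: "'c set"
    and vert :: "nat \<Rightarrow> 'c \<Rightarrow> 'd option \<Rightarrow> real ^ 'd"
    and f :: "real \<Rightarrow> real ^ 'd"
    and ghat :: "real ^ 'd \<Rightarrow> real \<Rightarrow> real \<Rightarrow> real ^ 'd \<Rightarrow> real"
    and bc :: "real \<Rightarrow> ('c \<Rightarrow> real ^ 'd \<Rightarrow> real) \<Rightarrow> 'c \<Rightarrow> real ^ 'd \<Rightarrow> real"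
    and \<alpha> \<beta> :: "nat \<Rightarrow> nat \<Rightarrow> real" and \<gamma> :: "nat \<Rightarrow> real"
    and U :: "nat \<Rightarrow> 'c \<Rightarrow> real ^ 'd \<Rightarrow> real"
    and S :: "nat \<Rightarrow> nat \<Rightarrow> 'c \<Rightarrow> real ^ 'd \<Rightarrow> real"
    and u\<^sub>h :: "nat \<Rightarrow> real ^ 'd \<Rightarrow> real"
  assumes mesh: "moving_mesh \<Omega> T N tlev cells vert \<kappa> \<tau>"
    and flux: "numerical_flux f ghat"
    and bc: "suitable_bc T cells bc"
    and rk: "tvd_rk s \<alpha> \<beta> \<gamma>"
    and order: "rk_order_ge s \<alpha> \<beta> \<gamma> CARD('d)"
    and scheme: "ale_dg_method s \<alpha> \<beta> \<gamma> N tlev cells vert k f ghat bc U S"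
    and well_defined:
      "\<And>n K i. n < N \<Longrightarrow> K \<in> cells \<Longrightarrow> i \<le> s \<Longrightarrow> stage_metric \<alpha> \<beta> \<gamma> tlev vert n K i \<noteq> 0"
    and uh_space: "\<And>n. n \<le> N \<Longrightarrow> u\<^sub>h n \<in> dg_space \<Omega> cells (vert n) k"
    and uh_pull_back: "\<And>n. n \<le> N \<Longrightarrow> is_pull_back \<Omega> cells (vert n) (u\<^sub>h n) (U n)"
  shows "\<forall>c :: real. \<forall>n<N. (\<forall>x\<in>\<Omega>. u\<^sub>h n x = c) \<longrightarrow> (\<forall>x\<in>\<Omega>. u\<^sub>h (Suc n) x = c)"
proof (intro allI impI)
  fix c n assume n: "n < N" and init: "\<forall>x\<in>\<Omega>. u\<^sub>h n x = c"
  define dt where "dt = tlev (Suc n) - tlev n"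
  have lt: "tlev m < tlev (Suc m)" if "m < N" for m
    using mesh that by (simp add: moving_mesh_def)
  have mono: "tlev i \<le> tlev j" if "i \<le> j" "j \<le> N" for i j
    using that by (induction j rule: dec_induct) (auto intro: order_trans[OF _ less_imp_le[OF lt]])
  \<comment> \<open>Compatibility of the boundary condition with constants is available for times in
    \<open>{0..T}\<close>.\<close>
  have T: "{tlev n..tlev (Suc n)} \<subseteq> {0..T}"
    using mono[of 0 n] mono[of "Suc n" N] n mesh by (auto simp: moving_mesh_def)
  have U_poly: "U m K \<in> poly_space k" if "m \<le> N" "K \<in> cells" for m K
    using scheme that by (simp add: ale_dg_method_def)
  have S_poly: "S n i K \<in> poly_space k" if "i \<le> s" "K \<in> cells" for i K
    using scheme that n by (simp add: ale_dg_method_def)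
  have U_init: "U n K = (\<lambda>_. c)" if K: "K \<in> cells" for K
  proof (rule eq_const_if_interior_ref_simplex)
    show "real_polynomial_function (U n K)"
      using poly_space_imp_real_polynomial_function[OF U_poly[of n K]] n K by simp
    fix \<xi> :: "real ^ 'd" assume \<xi>: "\<xi> \<in> interior ref_simplex"
    then have "cell_map (vert n K) \<xi> \<in> \<Omega>"
      using mesh n K by (intro cell_map_interior[where V = "vert n"]) (auto simp: moving_mesh_def)
    then show "U n K \<xi> = c"
      using uh_pull_back[of n] n K \<xi> init by (auto simp: is_pull_back_def)
  qed
  \<comment> \<open>Strong induction with the cell generalised: a stage draws on all earlier stages
    and, through the exterior traces, on other cells.\<close>
  have stage: "S n i K = (\<lambda>_. c)" if "i \<le> s" "K \<in> cells" for i K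
    using that
  proof (induction i arbitrary: K rule: less_induct)
    case (less i)
    define J where "J = stage_metric \<alpha> \<beta> \<gamma> tlev vert n K"
    define D where "D j = divergence (\<lambda>\<xi>. matrix_inv (cell_matrix (vert_at tlev vert n (tlev n + \<gamma> j * dt) K))
      *v grid_velocity tlev vert n (tlev n + \<gamma> j * dt) K \<xi>) 0" for j
    show ?case
    proof (rule ref_inner_eq_imp_const)
      show "S n i K \<in> poly_space k" "J i \<noteq> 0"
        using S_poly less.prems well_defined n by (auto simp: J_def)
      fix v :: "real ^ 'd \<Rightarrow> real" assume v: "v \<in> poly_space k"
      define I where "I = (LINT \<xi>:ref_simplex|lborel. v \<xi>)"
      show "ref_inner (\<lambda>\<xi>. J i * S n i K \<xi>) v = ref_inner (\<lambda>\<xi>. J i * c) v"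
      proof (cases "i = 0")
        case True
        have "J 0 = det (cell_matrix (vert n K))"
          by (simp add: J_def stage_metric.simps)
        moreover have "ref_inner (\<lambda>\<xi>. J 0 * S n 0 K \<xi>) v
            = ref_inner (\<lambda>\<xi>. det (cell_matrix (vert n K)) * U n K \<xi>) v"
          using scheme n less.prems v by (simp add: ale_dg_method_def Let_def J_def)
        ultimately show ?thesis
          using True U_init[OF less.prems(2)] by simp
      next
        case False
        then have "i \<in> {1..s}"
          using less.prems by simp
        have IH: "S n j L = (\<lambda>_. c)" if "j < i" "L \<in> cells" for j L
          using less.IH less.prems that by simp
        have form: "ale_form tlev cells vert f ghat bc n K (S n j) v (J j) (tlev n + \<gamma> j * dt)
            = c * J j * D j * I" if "j < i" for j
          unfolding D_def I_def
        proof (rule ale_form_const[OF flux bc lt[OF n] _ _ less.prems(2) _ v])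
          have "0 \<le> \<gamma> j" "\<gamma> j \<le> 1" "0 < dt"
            using rk that less.prems lt[OF n] by (auto simp: tvd_rk_def dt_def)
          then have "0 \<le> \<gamma> j * dt" "\<gamma> j * dt \<le> 1 * dt"
            by (auto intro: mult_right_mono)
          then show "tlev n + \<gamma> j * dt \<in> {tlev n..tlev (Suc n)}"
            by (auto simp: dt_def)
          with T show "tlev n + \<gamma> j * dt \<in> {0..T}"
            by blast
        qed (use IH that in auto)
        have J: "J i = (\<Sum>j<i. \<alpha> i j * J j + \<beta> i j * dt * D j * J j)"
          unfolding J_def by (subst stage_metric.simps) (simp add: False Let_def D_def dt_def)
        have "ref_inner (\<lambda>\<xi>. J i * S n i K \<xi>) v
            = (\<Sum>j<i. \<alpha> i j * ref_inner (\<lambda>\<xi>. J j * S n j K \<xi>) v)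
            + (\<Sum>j<i. \<beta> i j * dt *
                ale_form tlev cells vert f ghat bc n K (S n j) v (J j) (tlev n + \<gamma> j * dt))"
          using scheme n less.prems(2) v \<open>i \<in> {1..s}\<close>
          by (simp add: ale_dg_method_def Let_def J_def dt_def)
        also have "\<dots> = (\<Sum>j<i. \<alpha> i j * (J j * c * I)) + (\<Sum>j<i. \<beta> i j * dt * (c * J j * D j * I))"
          using IH[OF _ less.prems(2)] form by (simp add: ref_inner_const I_def)
        \<comment> \<open>Up to the common factor \<open>c * I\<close> the two sums form the
          recursion for \<open>J i\<close>: here it matters that the metric terms are advanced by
          the same Runge-Kutta method.\<close>
        also have "\<dots> = J i * c * I"
          unfolding J sum_distrib_right sum.distrib[symmetric]
          by (intro sum.cong refl) (simp add: algebra_simps)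
        also have "\<dots> = ref_inner (\<lambda>\<xi>. J i * c) v"
          by (simp add: ref_inner_const I_def)
        finally show ?thesis .
      qed
    qed
  qed
  have U_next: "U (Suc n) K = (\<lambda>_. c)" if K: "K \<in> cells" for K
  proof (rule ref_inner_eq_imp_const)
    show "U (Suc n) K \<in> poly_space k" "stage_metric \<alpha> \<beta> \<gamma> tlev vert n K s \<noteq> 0"
      using U_poly well_defined n K by auto
    show "ref_inner (\<lambda>\<xi>. stage_metric \<alpha> \<beta> \<gamma> tlev vert n K s * U (Suc n) K \<xi>) v
        = ref_inner (\<lambda>\<xi>. stage_metric \<alpha> \<beta> \<gamma> tlev vert n K s * c) v" if "v \<in> poly_space k" for v
      using scheme n K that stage[OF order_refl K] by (simp add: ale_dg_method_def Let_def)
  qed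
  \<comment> \<open>By the second clause of \<open>is_pull_back\<close> every point of
    \<open>\<Omega>\<close>, interface points included, takes a value of some pull-back, and all of
    these are \<open>c\<close>.\<close>
  show "\<forall>x\<in>\<Omega>. u\<^sub>h (Suc n) x = c"
    using uh_pull_back[of "Suc n"] n U_next by (fastforce simp: is_pull_back_def)
qed

end
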